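(* Let $X$ be a real infinite-dimensional Banach space belonging to the class $\mathcal{K}$ (defined in the context). Then $X$ does not contain a non-empty open bounded set that is a $G_\delta$ set in the weak topology. Moreover, if in addition $X$ is separable and $G \subset X$ is a non-empty convex bounded open set, then there is no countable family $\{F_n\}_{n=1}^\infty$ of weakly closed subsets of $X$ such that $G \cap \bigcup_{n=1}^\infty F_n = \emptyset$ and $\bigcup_{n=1}^\infty F_n$ contains all smooth points of the norm closure $\mathrm{cl}\,G$. In particular, if $X\in\mathcal{K}$ is separable, $G \subset X$ is a convex bounded open set and $0 \in G$, then the set $w^*\text{-}\exp G^\circ$ of all $w^*$-exposed points of the polar $G^\circ$ is uncountable.
   Context: $B_X$ denotes the closed unit ball of $X$ and $\mathrm{int}\,B_X$ its (norm) interior. "Open", "closed", "bounded", "diameter" refer to the norm unless the weak topology is mentioned. A weak-$G_\delta$ set is a countable intersection of weakly open sets. Fragmentability: a set $M \subset X$ is fragmentable if for every non-empty subset $A$ of $M$ and every $\varepsilon>0$ there is a weakly open set $V \subset X$ with $A \cap V \neq \emptyset$ and $\mathrm{diam}(A \cap V) < \varepsilon$. Class $\mathcal{K}$: a Banach space $X$ belongs to $\mathcal{K}$ if $X$ contains a non-empty fragmentable set $M \subset \mathrm{int}\,B_X$ such that: for every $\varepsilon>0$, every weakly open set $V$ and every $x_0 \in V \cap M$, there is a finite sequence $\{x_i\}_{i=1}^n \subset V \cap M$ such that $\|x_i - x_{i-1}\| < \varepsilon$ for $i=1,\dots,n$, and $\|x_n\| \geq 1-\varepsilon$. Smooth points: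 if $C \subset X$ is a bounded closed convex set with $0 \in \mathrm{int}\,C$, a point $x \in \partial C$ is smooth (for $C$) if the Minkowski functional of $C$ is Gâteaux differentiable at $x$. If $C$ is a bounded closed convex set with non-empty interior not necessarily containing $0$, then $x\in\partial C$ is smooth for $C$ if $x-a$ is smooth for $C-a$, where $a \in \mathrm{int}\,C$ (this does not depend on $a$). Polar: $G^\circ = \{f \in X^* : f(x) \leq 1 \text{ for all } x \in G\}$. $w^*$-exposed points: a point $f$ of a set $A \subset X^*$ is a $w^*$-exposed point of $A$ if there is $x \in X$ such that $f(x) > g(x)$ for every $g \in A$ with $g \neq f$. *)

theory Defs
  imports "HOL-Analysis.Analysis"
begin

definition weak_topology :: "'a::real_normed_vector topology" where
  "weak_topology = topology_generated_by
     {blinfun_apply f -` U | (f :: 'a \<Rightarrow>\<^sub>L real) U. open U}"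

lemma topspace_weak_topology [simp]:
  "topspace (weak_topology :: 'a::real_normed_vector topology) = UNIV"
proof -
  have "(UNIV :: 'a set) \<in> {blinfun_apply f -` U | (f :: 'a \<Rightarrow>\<^sub>L real) U. open U}"
    using open_UNIV vimage_UNIV by blast
  then show ?thesis
    unfolding weak_topology_def topology_generated_by_topspace by blast
qed

(* The boundedness requirement is needed because diameter has no meaningful value
   on unbounded sets, whose diameter is infinite in the usual convention. *)
definition fragmentable :: "'a::real_normed_vector set \<Rightarrow> bool" where
  "fragmentable M \<longleftrightarrow>
     (\<forall>A \<epsilon>. A \<subseteq> M \<longrightarrow> A \<noteq> {} \<longrightarrow> \<epsilon> > 0 \<longrightarrow>
        (\<exists>V. openin weak_topology V \<and> A \<inter> V \<noteq> {} \<and>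
             bounded (A \<inter> V) \<and> diameter (A \<inter> V) < \<epsilon>))"

definition class_K :: "'a::real_normed_vector itself \<Rightarrow> bool" where
  "class_K (_ :: 'a itself) \<longleftrightarrow>
     (\<exists>M :: 'a set. M \<noteq> {} \<and> M \<subseteq> interior (cball 0 1) \<and> fragmentable M \<and>
        (\<forall>\<epsilon>>0. \<forall>V. openin weak_topology V \<longrightarrow> (\<forall>x0 \<in> V \<inter> M.
           \<exists>(n::nat) (x :: nat \<Rightarrow> 'a). n \<ge> 1 \<and> x 0 = x0 \<and>
             (\<forall>i\<in>{1..n}. x i \<in> V \<inter> M \<and> norm (x i - x (i - 1)) < \<epsilon>) \<and>
             norm (x n) \<ge> 1 - \<epsilon>)))"

definition minkowski_functional :: "'a::real_vector set \<Rightarrow> 'a \<Rightarrow> real" where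
  "minkowski_functional C x = Inf {t. t > 0 \<and> x \<in> (*\<^sub>R) t ` C}"

definition gateaux_differentiable ::
    "('a::real_normed_vector \<Rightarrow> real) \<Rightarrow> 'a \<Rightarrow> bool" where
  "gateaux_differentiable p x \<longleftrightarrow>
     (\<exists>f :: 'a \<Rightarrow>\<^sub>L real. \<forall>h. ((\<lambda>t. (p (x + t *\<^sub>R h) - p x) / t) \<longlongrightarrow> blinfun_apply f h) (at 0))"

(* Meant for bounded closed convex C with non-empty interior; smoothness then does not
   depend on the interior point a, and a = 0 is admissible when 0 is interior to C. *)
definition smooth_point :: "'a::real_normed_vector set \<Rightarrow> 'a \<Rightarrow> bool" where
  "smooth_point C x \<longleftrightarrow> x \<in> frontier C \<and>
     (\<exists>a\<in>interior C.
        gateaux_differentiable (minkowski_functional ((\<lambda>y. y - a) ` C)) (x - a))"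

definition polar :: "'a::real_normed_vector set \<Rightarrow> ('a \<Rightarrow>\<^sub>L real) set" where
  "polar G = {f. \<forall>x\<in>G. blinfun_apply f x \<le> 1}"

definition wstar_exposed :: "('a::real_normed_vector \<Rightarrow>\<^sub>L real) set \<Rightarrow> ('a \<Rightarrow>\<^sub>L real) set" where
  "wstar_exposed A =
     {f \<in> A. \<exists>x. \<forall>g\<in>A. g \<noteq> f \<longrightarrow> blinfun_apply f x > blinfun_apply g x}"

end

theory Submission
  imports Defs
begin

text \<open>
  Let \<open>G\<close> be non-empty, open and bounded, contained in weakly open sets \<open>V\<^sub>n\<close>. After an affine change of
  variables the set \<open>M\<close> from the definition of \<open>\<K>\<close> meets \<open>G\<close>, and chains in \<open>M\<close> must leave \<open>G\<close>.
  Fragmenting \<open>W \<inter> M \<inter> G\<close> repeatedly, each time following a chain up to its exit from \<open>G\<close>, gives a Cauchy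
  sequence whose limit lies in all \<open>V\<^sub>n\<close> and in the closure of \<open>G\<close>, but not in \<open>G\<close>. Thus \<open>G\<close> is not weakly \<open>G\<^sub>\<delta>\<close>.

  To obtain such a point that is moreover smooth, apply this to the erosions of \<open>G\<close> and \<open>V\<^sub>n\<close> by a compact
  ellipsoid \<open>K\<close>, the image of the Hilbert ball under \<open>a \<mapsto> \<Sum>a\<^sub>i x\<^sub>i\<close> with \<open>x\<^sub>i\<close> a summable sequence of dense
  span; erosion by a compact set preserves weak openness. The resulting \<open>y\<close> satisfies \<open>y - K \<subseteq> cl G\<close> and some
  \<open>z \<in> y - K\<close> is a boundary point of \<open>G\<close>. There the gauge of \<open>cl G\<close> has a directional derivative that vanishes
  on the tangent hyperplane of the ellipsoid and is linear along \<open>z\<close>, hence linear. Finally, the derivative of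
  the gauge at a smooth point, normalised, is a weak-star exposed point of the polar, so countably many exposed
  points \<open>f\<^sub>n\<close> would give the forbidden family \<open>F\<^sub>n = {f\<^sub>n \<ge> 1}\<close>.
\<close>

section \<open>The weak topology\<close>

abbreviation weak_slab :: "('a::real_normed_vector \<Rightarrow>\<^sub>L real) set \<Rightarrow> 'a \<Rightarrow> real \<Rightarrow> 'a set" where
  "weak_slab \<Phi> x e \<equiv> {u. \<forall>f\<in>\<Phi>. \<bar>blinfun_apply f (u - x)\<bar> < e}"

lemma openin_weak_slab:
  fixes f :: "'a::real_normed_vector \<Rightarrow>\<^sub>L real"
  shows "openin weak_topology {u. \<bar>blinfun_apply f (u - x)\<bar> < e}"
proof -
  have "{u. \<bar>blinfun_apply f (u - x)\<bar> < e} = blinfun_apply f -` {blinfun_apply f x - e <..< blinfun_apply f x + e}"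
    by (auto simp: blinfun.diff_right abs_less_iff)
  then show ?thesis
    unfolding weak_topology_def
    by (intro topology_generated_by_Basis) (metis (mono_tags, lifting) mem_Collect_eq open_greaterThanLessThan)
qed

lemma openin_weak_slabs:
  assumes "finite \<Phi>"
  shows "openin weak_topology (weak_slab \<Phi> x e)"
  using assms
proof (induction \<Phi> rule: finite_induct)
  case empty
  then show ?case
    using openin_topspace[of weak_topology] by simp
next
  case (insert g \<Phi>)
  have "weak_slab (insert g \<Phi>) x e
      = {u. \<bar>blinfun_apply g (u - x)\<bar> < e} \<inter> weak_slab \<Phi> x e"
    by auto
  then show ?case
    using openin_Int[OF openin_weak_slab insert.IH] by simp
qed

text \<open>Replaces the inductive description of the generated topology by a neighbourhood base of
  finite slabs. In the induction, an intersection takes the union of the functional sets and the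
  smaller radius.\<close>

lemma openin_weak_iff:
  "openin weak_topology V \<longleftrightarrow>
    (\<forall>x\<in>V. \<exists>\<Phi> e. finite \<Phi> \<and> e > 0 \<and> weak_slab \<Phi> x e \<subseteq> V)"
    (is "_ \<longleftrightarrow> (\<forall>x\<in>V. ?P x V)")
proof
  assume "openin weak_topology V"
  then have "generate_topology_on {blinfun_apply f -` U | (f :: 'a \<Rightarrow>\<^sub>L real) U. open U} V"
    unfolding weak_topology_def by (rule openin_topology_generated_by)
  then show "\<forall>x\<in>V. ?P x V"
  proof induction
    case Empty
    then show ?case by simp
  next
    case (Int a b)
    show ?case
    proof
      fix x assume x: "x \<in> a \<inter> b"
      obtain \<Phi> d where 1: "finite \<Phi>" "d > 0" "weak_slab \<Phi> x d \<subseteq> a"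
        using Int x by (meson IntD1)
      obtain \<Psi> e where 2: "finite \<Psi>" "e > 0" "weak_slab \<Psi> x e \<subseteq> b"
        using Int x by (meson IntD2)
      have "{u. \<forall>f\<in>\<Phi> \<union> \<Psi>. \<bar>blinfun_apply f (u - x)\<bar> < min d e} \<subseteq> a \<inter> b"
        using 1 2 by fastforce
      moreover have "finite (\<Phi> \<union> \<Psi>)" "min d e > 0"
        using 1 2 by auto
      ultimately show "?P x (a \<inter> b)"
        by blast
    qed
  next
    case (UN K)
    show ?case
    proof
      fix x assume "x \<in> \<Union>K"
      then obtain k where k: "k \<in> K" "x \<in> k" by blast
      then have "?P x k" using UN by blast
      then show "?P x (\<Union>K)" using k by (meson Union_upper order_trans)
    qed
  next
    case (Basis s)
    then obtain f :: "'a \<Rightarrow>\<^sub>L real" and U where s: "s = blinfun_apply f -` U" "open U"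
      by blast
    show ?case
    proof
      fix x assume "x \<in> s"
      then obtain e where e: "e > 0" "ball (blinfun_apply f x) e \<subseteq> U"
        using s open_contains_ball by (metis vimage_eq)
      have "weak_slab {f} x e \<subseteq> s"
      proof
        fix u assume "u \<in> weak_slab {f} x e"
        then have "blinfun_apply f u \<in> ball (blinfun_apply f x) e"
          by (simp add: dist_real_def blinfun.diff_right abs_minus_commute)
        then show "u \<in> s" using e s by auto
      qed
      then show "?P x s" using e(1) by blast
    qed
  qed
next
  assume *: "\<forall>x\<in>V. ?P x V"
  show "openin weak_topology V"
  proof (subst openin_subopen, intro ballI)
    fix x assume "x \<in> V"
    then obtain \<Phi> e where "finite \<Phi>" "e > 0" "weak_slab \<Phi> x e \<subseteq> V"
      using * by blast
    then show "\<exists>T. openin weak_topology T \<and> x \<in> T \<and> T \<subseteq> V"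
      by (intro exI[of _ "weak_slab \<Phi> x e"]) (auto simp: openin_weak_slabs)
  qed
qed

lemma openin_weak_slabE:
  assumes "openin weak_topology V" "x \<in> V"
  obtains \<Phi> e where "finite \<Phi>" "e > 0" "weak_slab \<Phi> x e \<subseteq> V"
  using assms(1)[unfolded openin_weak_iff, rule_format, OF assms(2)] by blast

text \<open>Halving the radius of a slab leaves room for its non-strict version, which is norm
  closed. Norm closure is enough because only norm limits are taken later.\<close>

lemma openin_weak_shrink:
  assumes "openin weak_topology V" "x \<in> V"
  obtains N where "openin weak_topology N" "x \<in> N" "closure N \<subseteq> V"
proof -
  obtain \<Phi> e where \<Phi>: "finite \<Phi>" "e > 0" "weak_slab \<Phi> x e \<subseteq> V"
    using openin_weak_slabE[OF assms] .
  define N where "N = weak_slab \<Phi> x (e/2)"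
  have "closed {u. \<forall>f\<in>\<Phi>. \<bar>blinfun_apply f (u - x)\<bar> \<le> e/2}"
    unfolding Ball_def
    by (intro closed_Collect_all closed_Collect_imp closed_Collect_le open_Collect_const continuous_intros)
  moreover have "N \<subseteq> {u. \<forall>f\<in>\<Phi>. \<bar>blinfun_apply f (u - x)\<bar> \<le> e/2}"
    by (force simp: N_def)
  ultimately have "closure N \<subseteq> {u. \<forall>f\<in>\<Phi>. \<bar>blinfun_apply f (u - x)\<bar> \<le> e/2}"
    by (simp add: closure_minimal)
  also have "\<dots> \<subseteq> weak_slab \<Phi> x e"
    using \<open>e > 0\<close> by force
  finally have "closure N \<subseteq> V" using \<Phi>(3) by blast
  moreover have "openin weak_topology N" "x \<in> N"
    unfolding N_def using \<Phi> openin_weak_slabs[of \<Phi> x "e/2"] by auto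
  ultimately show ?thesis using that by blast
qed

lemma openin_weak_affine_vimage:
  assumes V: "openin weak_topology V"
  shows "openin weak_topology {x. c *\<^sub>R x + b \<in> V}"
  unfolding openin_weak_iff
proof
  fix x assume "x \<in> {x. c *\<^sub>R x + b \<in> V}"
  then obtain \<Phi> e where \<Phi>: "finite \<Phi>" "e > 0"
      "weak_slab \<Phi> (c *\<^sub>R x + b) e \<subseteq> V"
    using openin_weak_slabE[OF V, of "c *\<^sub>R x + b"] by blast
  \<comment> \<open>The summand \<open>1\<close> covers \<open>c = 0\<close> and makes the final
    inequality strict.\<close>
  let ?d = "e / (\<bar>c\<bar> + 1)"
  have "weak_slab \<Phi> x ?d \<subseteq> {x. c *\<^sub>R x + b \<in> V}"
  proof
    fix u assume u: "u \<in> weak_slab \<Phi> x ?d"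
    have "\<bar>blinfun_apply f (c *\<^sub>R u + b - (c *\<^sub>R x + b))\<bar> < e" if "f \<in> \<Phi>" for f
    proof -
      have "blinfun_apply f (c *\<^sub>R u + b - (c *\<^sub>R x + b)) = c * blinfun_apply f (u - x)"
        by (simp add: blinfun.bilinear_simps algebra_simps)
      moreover have "\<bar>c\<bar> * \<bar>blinfun_apply f (u - x)\<bar> \<le> \<bar>c\<bar> * ?d"
        using u that by (intro mult_left_mono) (auto intro: less_imp_le)
      moreover have "\<bar>c\<bar> * ?d < e"
        using \<Phi>(2) by (simp add: field_simps)
      ultimately show ?thesis by (simp add: abs_mult)
    qed
    then show "u \<in> {x. c *\<^sub>R x + b \<in> V}" using \<Phi>(3) by auto
  qed
  moreover have "?d > 0" using \<Phi>(2) by simp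
  ultimately show "\<exists>\<Phi> e. finite \<Phi> \<and> e > 0 \<and> weak_slab \<Phi> x e \<subseteq> {x. c *\<^sub>R x + b \<in> V}"
    using \<Phi>(1) by blast
qed

text \<open>Each slab radius is split in two: one half absorbs the move from \<open>k\<close> to a
  nearby \<open>k'\<close>, the other the move from \<open>y\<close> to \<open>u\<close>. The
  neighbourhoods \<open>N k\<close> are norm open, so norm compactness leaves finitely many slabs to
  respect.\<close>

lemma openin_weak_compact_erosion:
  assumes V: "openin weak_topology V" and K: "compact K"
  shows "openin weak_topology {y. \<forall>k\<in>K. y - k \<in> V}"
  unfolding openin_weak_iff
proof
  fix y assume y: "y \<in> {y. \<forall>k\<in>K. y - k \<in> V}"
  have "\<forall>k\<in>K. \<exists>p. finite (fst p) \<and> snd p > 0 \<and> weak_slab (fst p) (y - k) (snd p) \<subseteq> V"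
  proof
    fix k assume "k \<in> K"
    then obtain \<Phi> e where "finite \<Phi>" "e > 0" "weak_slab \<Phi> (y - k) e \<subseteq> V"
      using openin_weak_slabE[OF V, of "y - k"] y by blast
    then show "\<exists>p. finite (fst p) \<and> snd p > 0 \<and> weak_slab (fst p) (y - k) (snd p) \<subseteq> V"
      by (intro exI[of _ "(\<Phi>, e)"]) simp
  qed
  from bchoice[OF this] obtain p where
    p: "\<forall>k\<in>K. finite (fst (p k)) \<and> snd (p k) > 0 \<and> weak_slab (fst (p k)) (y - k) (snd (p k)) \<subseteq> V" ..
  define \<Phi> where "\<Phi> k = fst (p k)" for k
  define e where "e k = snd (p k)" for k
  have \<Phi>: "\<And>k. k \<in> K \<Longrightarrow> finite (\<Phi> k)" "\<And>k. k \<in> K \<Longrightarrow> e k > 0"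
      "\<And>k. k \<in> K \<Longrightarrow> weak_slab (\<Phi> k) (y - k) (e k) \<subseteq> V"
    using p by (auto simp: \<Phi>_def e_def)
  define N where "N k = {k'. \<forall>f\<in>\<Phi> k. \<bar>blinfun_apply f (k' - k)\<bar> < e k / 2}" for k
  have "open (N k)" if "k \<in> K" for k
  proof -
    have "N k = (\<Inter>f\<in>\<Phi> k. {k'. \<bar>blinfun_apply f (k' - k)\<bar> < e k / 2})"
      by (auto simp: N_def)
    then show ?thesis
      using \<Phi>(1)[OF that] by (auto intro!: open_INT open_Collect_less continuous_intros)
  qed
  moreover have "K \<subseteq> (\<Union>k\<in>K. N k)"
    using \<Phi>(2) by (force simp: N_def)
  ultimately obtain D where D: "D \<subseteq> K" "finite D" "K \<subseteq> (\<Union>k\<in>D. N k)"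
    using compactE_image[OF K] by metis
  \<comment> \<open>Inserting \<open>1\<close> keeps the argument of \<open>Min\<close> non-empty
    when \<open>D\<close> is empty.\<close>
  define d where "d = Min (insert 1 ((\<lambda>k. e k / 2) ` D))"
  have "d > 0"
    using D \<Phi>(2) by (auto simp: d_def)
  have d: "d \<le> e k / 2" if "k \<in> D" for k
    unfolding d_def by (rule Min_le) (use that D in auto)
  have "weak_slab (\<Union>k\<in>D. \<Phi> k) y d \<subseteq> {y. \<forall>k\<in>K. y - k \<in> V}"
  proof (intro subsetI CollectI ballI)
    fix u k'
    assume u: "u \<in> weak_slab (\<Union>k\<in>D. \<Phi> k) y d" and "k' \<in> K"
    then obtain k where k: "k \<in> D" "k' \<in> N k" using D by blast
    have "\<bar>blinfun_apply f (u - k' - (y - k))\<bar> < e k" if "f \<in> \<Phi> k" for f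
    proof -
      have "\<bar>blinfun_apply f (u - y)\<bar> < d" "\<bar>blinfun_apply f (k' - k)\<bar> < e k / 2"
        using u k that by (auto simp: N_def)
      then have "\<bar>blinfun_apply f (u - y) - blinfun_apply f (k' - k)\<bar> < e k"
        using d[OF k(1)] by linarith
      moreover have "blinfun_apply f (u - k' - (y - k)) = blinfun_apply f (u - y) - blinfun_apply f (k' - k)"
        by (simp add: blinfun.diff_right)
      ultimately show ?thesis
        by simp
    qed
    then show "u - k' \<in> V" using \<Phi>(3)[of k] D k by blast
  qed
  moreover have "finite (\<Union>k\<in>D. \<Phi> k)" using D \<Phi>(1) by blast
  ultimately show "\<exists>\<Phi> e. finite \<Phi> \<and> e > 0 \<and> weak_slab \<Phi> y e \<subseteq> {y. \<forall>k\<in>K. y - k \<in> V}"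
    using \<open>d > 0\<close> by blast
qed

section \<open>Boundary points through fragmentability\<close>

text \<open>The chain clause of \<open>class_K\<close> for a fixed set \<open>M\<close>, separated
  from fragmentability.\<close>

definition weak_chain_property :: "'a::real_normed_vector set \<Rightarrow> bool" where
  "weak_chain_property M \<longleftrightarrow>
     (\<forall>\<epsilon>>0. \<forall>V. openin weak_topology V \<longrightarrow> (\<forall>x0 \<in> V \<inter> M.
        \<exists>(n::nat) (x :: nat \<Rightarrow> 'a). n \<ge> 1 \<and> x 0 = x0 \<and>
          (\<forall>i\<in>{1..n}. x i \<in> V \<inter> M \<and> norm (x i - x (i - 1)) < \<epsilon>) \<and> norm (x n) \<ge> 1 - \<epsilon>))"

text \<open>A chain starts in \<open>G\<close> and ends with norm above \<open>r\<close>, hence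
  outside \<open>G\<close>. The pair consists of its first point outside \<open>G\<close> and the
  point just before it, which still lies in \<open>W \<inter> M\<close>.\<close>

lemma weak_chain_exit:
  assumes M: "weak_chain_property M" and G: "G \<subseteq> cball 0 r" "r < 1"
    and W: "openin weak_topology W" and x0: "x0 \<in> W \<inter> M \<inter> G" and "\<epsilon> > 0"
  obtains y w where "y \<in> W \<inter> M \<inter> G" "w \<notin> G" "dist w y < \<epsilon>"
proof -
  \<comment> \<open>The bound \<open>(1 - r) / 2\<close> ensures \<open>1 - \<delta> > r\<close>, so
    the end of the chain is outside \<open>G\<close>.\<close>
  define \<delta> where "\<delta> = min \<epsilon> ((1 - r) / 2)"
  have \<delta>: "\<delta> > 0" using assms by (auto simp: \<delta>_def)
  have "x0 \<in> W \<inter> M" using x0 by blast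
  from M[unfolded weak_chain_property_def, rule_format, OF \<delta> W this]
  obtain n :: nat and x where x: "x 0 = x0" "norm (x n) \<ge> 1 - \<delta>"
      "\<And>i. i \<in> {1..n} \<Longrightarrow> x i \<in> W \<inter> M \<and> norm (x i - x (i - 1)) < \<delta>"
    by blast
  have "1 - \<delta> > r" using G(2) \<delta> by (auto simp: \<delta>_def min_def field_simps)
  then have "x n \<notin> G" using G x(2) by force
  moreover have "x 0 \<in> G" using x0 x by auto
  ultimately obtain m where m: "m < n" "\<forall>i\<le>m. x i \<in> G" "x (Suc m) \<notin> G"
    using ex_least_nat_less[of "\<lambda>i. x i \<notin> G" n] by auto
  \<comment> \<open>Index \<open>0\<close> is treated apart: the chain condition speaks about
    \<open>{1..n}\<close>, while \<open>x 0\<close> is the given \<open>x0\<close>.\<close>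
  have "x m \<in> W \<inter> M"
    using x(1) x(3)[of m] x0 m(1) by (cases "m = 0") auto
  moreover have "dist (x (Suc m)) (x m) < \<epsilon>"
    using x(3)[of "Suc m"] m(1) by (auto simp: dist_norm \<delta>_def)
  ultimately show ?thesis using that m by blast
qed

text \<open>Dependent choice on pairs of a weakly open set and a point of it in
  \<open>M \<inter> G\<close>. Small diameters make the points Cauchy, the closures in
  \<open>V n\<close> capture the limit, and nearby points outside \<open>G\<close> keep the limit
  out of the open set \<open>G\<close>.\<close>

lemma fragmentable_boundary_point_normalized:
  fixes M :: "'a::banach set"
  assumes frag: "fragmentable M" and chain: "weak_chain_property M"
    and G: "open G" "G \<subseteq> cball 0 r" "r < 1" and m0: "m0 \<in> M \<inter> G"
    and V: "\<And>n. openin weak_topology (V n)" "\<And>n. G \<subseteq> V n"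
  shows "\<exists>y \<in> closure G - G. \<forall>n::nat. y \<in> V n"
proof -
  define P where "P n p \<longleftrightarrow> openin weak_topology (fst p) \<and> snd p \<in> fst p \<inter> M \<inter> G" for n :: nat and p :: "'a set \<times> 'a"
  define Q where "Q n p p' \<longleftrightarrow> fst p' \<subseteq> fst p \<and> closure (fst p') \<subseteq> V n \<and>
      (\<forall>u \<in> fst p' \<inter> M \<inter> G. \<forall>v \<in> fst p' \<inter> M \<inter> G. dist u v < (1/2)^n) \<and>
      (\<exists>w. w \<notin> G \<and> dist w (snd p') < (1/2)^n)" for n and p p' :: "'a set \<times> 'a"
  have "\<exists>p. P 0 p"
    using m0 openin_topspace[of "weak_topology :: 'a topology"]
    by (intro exI[of _ "(UNIV, m0)"]) (auto simp: P_def)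
  moreover have "\<exists>p'. P (Suc n) p' \<and> Q n p p'" if p: "P n p" for n p
  proof -
    obtain W y where [simp]: "p = (W, y)" by fastforce
    have W: "openin weak_topology W" "y \<in> W \<inter> M \<inter> G" using p by (auto simp: P_def)
    have e: "(1/2::real)^n > 0" by simp
    \<comment> \<open>The sets are shrunk first, by fragmentability and by weak regularity around
      \<open>x0\<close>. Only then does a chain move the point towards the complement of
      \<open>G\<close>, so the new point stays in the small set \<open>W'\<close>.\<close>
    obtain U where U: "openin weak_topology U" "(W \<inter> M \<inter> G) \<inter> U \<noteq> {}"
        "bounded ((W \<inter> M \<inter> G) \<inter> U)" "diameter ((W \<inter> M \<inter> G) \<inter> U) < (1/2)^n"
      using frag[unfolded fragmentable_def, rule_format, of "W \<inter> M \<inter> G" "(1/2)^n"] W(2) e by blast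
    then obtain x0 where x0: "x0 \<in> (W \<inter> M \<inter> G) \<inter> U" by blast
    obtain N where N: "openin weak_topology N" "x0 \<in> N" "closure N \<subseteq> V n"
      using openin_weak_shrink[OF V(1)[of n], of x0] V(2) x0 by blast
    define W' where "W' = W \<inter> U \<inter> N"
    have W': "openin weak_topology W'" using W U N by (auto simp: W'_def)
    obtain y' w where y': "y' \<in> W' \<inter> M \<inter> G" "w \<notin> G" "dist w y' < (1/2)^n"
      using weak_chain_exit[OF chain G(2,3) W', of x0 "(1/2)^n"] x0 N by (auto simp: W'_def)
    have "dist u v < (1/2)^n" if "u \<in> W' \<inter> M \<inter> G" "v \<in> W' \<inter> M \<inter> G" for u v
    proof -
      have "dist u v \<le> diameter ((W \<inter> M \<inter> G) \<inter> U)"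
        using that by (intro diameter_bounded_bound U) (auto simp: W'_def)
      then show ?thesis using U by linarith
    qed
    moreover have "closure W' \<subseteq> V n"
      using N(3) closure_mono[of W' N] by (auto simp: W'_def)
    ultimately show ?thesis
      using y' W' by (intro exI[of _ "(W', y')"]) (auto simp: P_def Q_def W'_def)
  qed
  ultimately obtain p where p: "\<And>n. P n (p n)" "\<And>n. Q n (p n) (p (Suc n))"
    using dependent_nat_choice[of P Q] by blast
  \<comment> \<open>The shift drops the initial state, about which \<open>Q\<close> says nothing;
    \<open>W n\<close> then has the bounds belonging to \<open>(1/2)^n\<close> and
    \<open>V n\<close>.\<close>
  define W where "W n = fst (p (Suc n))" for n
  define y where "y n = snd (p (Suc n))" for n
  have y: "y n \<in> W n \<inter> M \<inter> G" for n
    using p(1)[of "Suc n"] by (auto simp: P_def W_def y_def)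
  have Wmono: "W (Suc n) \<subseteq> W n" and Wcl: "closure (W n) \<subseteq> V n"
    and Wd: "\<And>u v. u \<in> W n \<inter> M \<inter> G \<Longrightarrow> v \<in> W n \<inter> M \<inter> G \<Longrightarrow> dist u v < (1/2)^n"
    and Wex: "\<exists>w. w \<notin> G \<and> dist w (y n) < (1/2)^n" for n
    using p(2)[of "Suc n"] p(2)[of n] by (auto simp: Q_def W_def y_def)
  have "W m \<subseteq> W n" if "n \<le> m" for m n
    using lift_Suc_antimono_le[of W, OF Wmono that] .
  then have yW: "y m \<in> W n \<inter> M \<inter> G" if "n \<le> m" for m n
    using y that by blast
  have half: "(\<lambda>n. (1/2::real)^n) \<longlonglongrightarrow> 0"
    by (intro LIMSEQ_power_zero) auto
  have "Cauchy y"
  proof (rule metric_CauchyI)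
    fix e :: real assume "e > 0"
    then obtain n where "(1/2)^n < e"
      using real_arch_pow_inv[of e "1/2"] by auto
    then show "\<exists>N. \<forall>m\<ge>N. \<forall>k\<ge>N. dist (y m) (y k) < e"
      using Wd[OF yW yW, of n] by (intro exI[of _ n]) (auto intro: order_less_trans)
  qed
  then obtain l where l: "y \<longlonglongrightarrow> l"
    using Cauchy_convergent convergentD by blast
  have "l \<in> V n" for n
  proof -
    have "l \<in> closure (W n)"
      unfolding closure_sequential
      using LIMSEQ_ignore_initial_segment[OF l, of n] yW[of n] by (intro exI[of _ "\<lambda>m. y (m + n)"]) auto
    then show ?thesis using Wcl by blast
  qed
  moreover have "l \<in> closure G"
    using l y closure_sequential by (metis IntD2)
  moreover have "l \<notin> G"
  proof -
    obtain w where w: "\<And>n. w n \<notin> G" "\<And>n. dist (w n) (y n) < (1/2)^n"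
      using Wex by metis
    have "(\<lambda>n. dist (w n) (y n)) \<longlonglongrightarrow> 0"
      by (rule tendsto_sandwich[OF _ _ tendsto_const half]) (auto intro!: always_eventually less_imp_le w)
    then have "(\<lambda>n. w n - y n) \<longlonglongrightarrow> 0"
      by (simp add: dist_norm tendsto_norm_zero_iff)
    then have "w \<longlonglongrightarrow> l"
      by (rule Lim_transform[OF l])
    then show ?thesis
      using closed_sequentially[of "- G" w l] w(1) G(1) by (auto simp: closed_def)
  qed
  ultimately show ?thesis by blast
qed

lemma class_K_boundary_point:
  fixes G :: "'a::banach set"
  assumes K: "class_K TYPE('a)" and G: "G \<noteq> {}" "open G" "bounded G"
    and V: "\<And>n. openin weak_topology (V n)" "\<And>n. G \<subseteq> V n"
  shows "\<exists>y \<in> closure G - G. \<forall>n::nat. y \<in> V n"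
proof -
  obtain M :: "'a set" where M: "M \<noteq> {}" "M \<subseteq> interior (cball 0 1)" "fragmentable M" "weak_chain_property M"
    using K unfolding class_K_def weak_chain_property_def by auto
  obtain m where m: "m \<in> M" using M by blast
  \<comment> \<open>A non-zero interior point of the ball can be pushed outwards along itself by
    \<open>e / 2\<close>, which forces its norm below 1.\<close>
  have m1: "norm m < 1"
  proof (cases "m = 0")
    case False
    obtain e where e: "e > 0" "ball m e \<subseteq> cball 0 1"
      using M(2) m mem_interior by blast
    have "m + (e / (2 * norm m)) *\<^sub>R m \<in> ball m e"
      using e False by (simp add: dist_norm)
    then have "norm ((1 + e / (2 * norm m)) *\<^sub>R m) \<le> 1"
      using e by (auto simp: algebra_simps)
    then have "(1 + e / (2 * norm m)) * norm m \<le> 1"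
      using e by simp
    moreover have "(1 + e / (2 * norm m)) * norm m = norm m + e / 2"
      using False by (simp add: field_simps)
    ultimately show ?thesis
      using e by linarith
  qed simp
  obtain g where g: "g \<in> G" using G by blast
  obtain R where R: "R > 0" "\<And>x. x \<in> G \<Longrightarrow> norm x \<le> R"
    using G(3) bounded_pos by metis
  define c where "c = (2 * R + 1) / (1 - norm m)"
  have c: "c > 0" using R m1 by (simp add: c_def)
  define T where "T x = c *\<^sub>R x + (g - c *\<^sub>R m)" for x
  define S where "S y = (1/c) *\<^sub>R (y - (g - c *\<^sub>R m))" for y
  have TS: "T (S y) = y" and ST: "S (T x) = x" for x y
    using c by (auto simp: T_def S_def)
  define r where "r = norm m + 2 * R / c"
  have "r < 1"
  proof -
    have "2 * R / c = (1 - norm m) * (2 * R / (2 * R + 1))"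
      using R m1 by (simp add: c_def)
    also have "\<dots> < (1 - norm m) * 1"
      using R m1 by (intro mult_strict_left_mono) auto
    finally show ?thesis by (simp add: r_def)
  qed
  have contT: "continuous_on UNIV T" and contS: "continuous_on UNIV S"
    unfolding T_def S_def by (intro continuous_intros)+
  have "T -` G \<subseteq> cball 0 r"
  proof
    fix x assume "x \<in> T -` G"
    then have "norm (T x - g) \<le> 2 * R"
      using R(2)[of "T x"] R(2)[OF g] norm_triangle_ineq4[of "T x" g] by auto
    moreover have "T x - g = c *\<^sub>R (x - m)" by (simp add: T_def algebra_simps)
    ultimately have "c * norm (x - m) \<le> 2 * R"
      using c by simp
    then have "norm (x - m) \<le> 2 * R / c"
      using c by (simp add: pos_le_divide_eq mult.commute)
    then show "x \<in> cball 0 r"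
      using norm_triangle_ineq2[of x m] by (simp add: r_def)
  qed
  moreover have "open (T -` G)" using contT G(2) by (simp add: open_vimage)
  moreover have "m \<in> M \<inter> T -` G" using m g by (simp add: T_def)
  moreover have "openin weak_topology (T -` V n)" for n
    using openin_weak_affine_vimage[OF V(1)[of n], of c "g - c *\<^sub>R m"]
    by (simp add: T_def vimage_def)
  moreover have "T -` G \<subseteq> T -` V n" for n using V(2) by blast
  ultimately obtain x where x: "x \<in> closure (T -` G)" "T x \<notin> G" "\<And>n. T x \<in> V n"
    using fragmentable_boundary_point_normalized[OF M(3,4), of "T -` G" r m "\<lambda>n. T -` V n"] \<open>r < 1\<close>
    by auto
  have "T ` closure (T -` G) \<subseteq> closure G"
    using closure_subset[of G] by (intro image_closure_subset continuous_on_subset[OF contT]) auto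
  then have "T x \<in> closure G"
    using x(1) by blast
  then show ?thesis using x by blast
qed

section \<open>Directional derivatives of sublinear functionals\<close>

definition sublinear :: "('a::real_normed_vector \<Rightarrow> real) \<Rightarrow> bool" where
  "sublinear p \<longleftrightarrow> (\<forall>u v. p (u + v) \<le> p u + p v) \<and> (\<forall>c u. c \<ge> 0 \<longrightarrow> p (c *\<^sub>R u) = c * p u)"

lemma sublinear_add: "sublinear p \<Longrightarrow> p (u + v) \<le> p u + p v"
  and sublinear_scale: "sublinear p \<Longrightarrow> c \<ge> 0 \<Longrightarrow> p (c *\<^sub>R u) = c * p u"
  by (auto simp: sublinear_def)

lemma sublinear_zero: "sublinear p \<Longrightarrow> p 0 = 0"
  using sublinear_scale[of p 0 0] by simp

lemma sublinear_minus: "sublinear p \<Longrightarrow> 0 \<le> p u + p (- u)"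
  using sublinear_add[of p u "- u"] sublinear_zero[of p] by simp

lemma sublinear_diff: "sublinear p \<Longrightarrow> p u \<le> p v + p (u - v)"
  using sublinear_add[of p v "u - v"] by simp

text \<open>The one-sided directional derivative. For sublinear \<open>p\<close> the quotients
  increase with \<open>s\<close>, so the infimum equals the right limit and estimates can use a
  single \<open>s\<close>.\<close>

definition directional :: "('a::real_normed_vector \<Rightarrow> real) \<Rightarrow> 'a \<Rightarrow> 'a \<Rightarrow> real" where
  "directional p z h = (INF s\<in>{0<..}. (p (z + s *\<^sub>R h) - p z) / s)"

context
  fixes p :: "'a::real_normed_vector \<Rightarrow> real" and z :: 'a
  assumes p: "sublinear p"
begin

lemma directional_le:
  assumes "s > 0"
  shows "directional p z h \<le> (p (z + s *\<^sub>R h) - p z) / s"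
proof -
  \<comment> \<open>Subadditivity for \<open>z = (z + t *\<^sub>R h) + t *\<^sub>R (- h)\<close>
    bounds the quotients below, so that the real infimum is meaningful.\<close>
  have "- p (- h) \<le> (p (z + t *\<^sub>R h) - p z) / t" if "t > 0" for t
    using sublinear_add[OF p, of "z + t *\<^sub>R h" "t *\<^sub>R (- h)"] sublinear_scale[OF p, of t "- h"] that
    by (simp add: field_simps)
  then have "bdd_below ((\<lambda>s. (p (z + s *\<^sub>R h) - p z) / s) ` {0<..})"
    by (intro bdd_belowI[of _ "- p (- h)"]) auto
  then show ?thesis
    unfolding directional_def using assms by (intro cINF_lower) auto
qed

lemma directional_lessE:
  assumes "directional p z h < c"
  obtains s where "s > 0" "(p (z + s *\<^sub>R h) - p z) / s < c"
proof -
  have "\<exists>y\<in>(\<lambda>s. (p (z + s *\<^sub>R h) - p z) / s) ` {0<..}. y < c"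
    using assms unfolding directional_def by (intro cInf_lessD) auto
  then show ?thesis using that by auto
qed

text \<open>The point \<open>z + s *\<^sub>R h\<close> is a convex combination of \<open>z\<close>
  and \<open>z + t *\<^sub>R h\<close>; this is the usual slope inequality for convex
  functions.\<close>

lemma quotient_mono:
  assumes "0 < s" "s \<le> t"
  shows "(p (z + s *\<^sub>R h) - p z) / s \<le> (p (z + t *\<^sub>R h) - p z) / t"
proof -
  have "z + s *\<^sub>R h = (1 - s/t) *\<^sub>R z + (s/t) *\<^sub>R (z + t *\<^sub>R h)"
    using assms by (simp add: algebra_simps)
  then have "p (z + s *\<^sub>R h) \<le> (1 - s/t) * p z + (s/t) * p (z + t *\<^sub>R h)"
    using sublinear_add[OF p, of "(1 - s/t) *\<^sub>R z" "(s/t) *\<^sub>R (z + t *\<^sub>R h)"]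
      sublinear_scale[OF p, of "1 - s/t" z] sublinear_scale[OF p, of "s/t" "z + t *\<^sub>R h"] assms
    by simp
  then have "p (z + s *\<^sub>R h) - p z \<le> (s/t) * (p (z + t *\<^sub>R h) - p z)"
    by (simp add: algebra_simps)
  then show ?thesis
    using assms by (simp add: field_simps)
qed

lemma directional_tendsto:
  "((\<lambda>t. (p (z + t *\<^sub>R h) - p z) / t) \<longlongrightarrow> directional p z h) (at_right 0)"
proof (rule order_tendstoI)
  fix c assume "c < directional p z h"
  then show "\<forall>\<^sub>F t in at_right 0. c < (p (z + t *\<^sub>R h) - p z) / t"
    using directional_le by (intro eventually_at_rightI[of 0 1]) (auto intro: less_le_trans)
next
  fix c assume "directional p z h < c"
  then obtain s where s: "s > 0" "(p (z + s *\<^sub>R h) - p z) / s < c"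
    by (rule directional_lessE)
  then have "(p (z + t *\<^sub>R h) - p z) / t < c" if "0 < t" "t < s" for t
    using quotient_mono[of t s h] that by linarith
  then show "\<forall>\<^sub>F t in at_right 0. (p (z + t *\<^sub>R h) - p z) / t < c"
    using s(1) by (intro eventually_at_rightI[of 0 s]) auto
qed

lemma sublinear_directional: "sublinear (directional p z)"
  unfolding sublinear_def
proof (intro conjI allI impI)
  fix u v
  show "directional p z (u + v) \<le> directional p z u + directional p z v"
  proof (rule field_le_epsilon)
    fix e :: real assume "e > 0"
    obtain s where s: "s > 0" "(p (z + s *\<^sub>R u) - p z) / s < directional p z u + e/2"
      by (rule directional_lessE[of u "directional p z u + e/2"]) (use \<open>e > 0\<close> in auto)
    obtain t where t: "t > 0" "(p (z + t *\<^sub>R v) - p z) / t < directional p z v + e/2"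
      by (rule directional_lessE[of v "directional p z v + e/2"]) (use \<open>e > 0\<close> in auto)
    \<comment> \<open>By monotonicity a common step \<open>r\<close> is nearly optimal for both
      directions; the step \<open>r/2\<close> in direction \<open>u + v\<close> then reaches the
      midpoint of the two test points.\<close>
    define r where "r = min s t"
    have r: "r > 0" "(p (z + r *\<^sub>R u) - p z) / r < directional p z u + e/2"
        "(p (z + r *\<^sub>R v) - p z) / r < directional p z v + e/2"
      using s t quotient_mono[of r s u] quotient_mono[of r t v] by (auto simp: r_def)
    have "p (z + (r/2) *\<^sub>R (u + v)) \<le> (p (z + r *\<^sub>R u) + p (z + r *\<^sub>R v)) / 2"
    proof -
      have "z + (r/2) *\<^sub>R (u + v) = (1/2) *\<^sub>R (z + r *\<^sub>R u) + (1/2) *\<^sub>R (z + r *\<^sub>R v)"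
        by (simp add: algebra_simps flip: scaleR_add_left)
      then show ?thesis
        using sublinear_add[OF p, of "(1/2) *\<^sub>R (z + r *\<^sub>R u)" "(1/2) *\<^sub>R (z + r *\<^sub>R v)"]
          sublinear_scale[OF p, of "1/2"] by simp
    qed
    then have "(p (z + (r/2) *\<^sub>R (u + v)) - p z) / (r/2)
        \<le> (p (z + r *\<^sub>R u) - p z) / r + (p (z + r *\<^sub>R v) - p z) / r"
      using r(1) divide_right_mono[of "2 * p (z + (r/2) *\<^sub>R (u + v)) - 2 * p z" "p (z + r *\<^sub>R u) + p (z + r *\<^sub>R v) - 2 * p z" r]
      by (simp add: add_divide_distrib diff_divide_distrib mult.commute)
    then show "directional p z (u + v) \<le> directional p z u + directional p z v + e"
      using directional_le[of "r/2" "u + v"] r by linarith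
  qed
next
  fix c :: real and u assume c: "c \<ge> 0"
  show "directional p z (c *\<^sub>R u) = c * directional p z u"
  proof (cases "c = 0")
    case True
    then show ?thesis
      using p by (simp add: directional_def)
  next
    case False
    have le: "directional p z (d *\<^sub>R w) \<le> d * directional p z w" if d: "d > 0" for d w
    proof (rule field_le_epsilon)
      fix e :: real assume "e > 0"
      obtain s where s: "s > 0" "(p (z + s *\<^sub>R w) - p z) / s < directional p z w + e/d"
        by (rule directional_lessE[of w "directional p z w + e/d"]) (use \<open>e > 0\<close> d in auto)
      have "directional p z (d *\<^sub>R w) \<le> d * ((p (z + s *\<^sub>R w) - p z) / s)"
        using directional_le[of "s/d" "d *\<^sub>R w"] s(1) d by (simp add: field_simps)
      also have "\<dots> \<le> d * (directional p z w + e/d)"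
        using s d by (intro mult_left_mono) auto
      also have "\<dots> = d * directional p z w + e"
        using d by (simp add: algebra_simps)
      finally show "directional p z (d *\<^sub>R w) \<le> d * directional p z w + e" .
    qed
    have "directional p z u \<le> (1/c) * directional p z (c *\<^sub>R u)"
      using le[of "1/c" "c *\<^sub>R u"] False c by simp
    then have "c * directional p z u \<le> directional p z (c *\<^sub>R u)"
      using False c by (simp add: field_simps)
    then show ?thesis
      using le[of c u] False c by simp
  qed
qed

lemma directional_le_self: "directional p z h \<le> p h"
  using directional_le[of 1 h] sublinear_add[OF p, of z h] by simp

text \<open>Along the ray of \<open>z\<close> positive homogeneity determines \<open>p\<close>.
  Together with \<open>directional_le_self\<close> this makes the derivative linear in the direction
  \<open>z\<close>.\<close>

lemma directional_minus_self: "directional p z (- z) \<le> - p z"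
proof -
  have "z + (1/2) *\<^sub>R (- z) = (1 - 1/2) *\<^sub>R z"
    by (simp only: scaleR_left_diff_distrib scaleR_minus_right) simp
  then have "p (z + (1/2) *\<^sub>R (- z)) = p z / 2"
    using sublinear_scale[OF p, of "1/2" z] by simp
  then show ?thesis
    using directional_le[of "1/2" "- z"] by simp
qed

text \<open>An odd sublinear functional is linear, and the bound by \<open>C * norm u\<close> makes
  it continuous, so the directional derivative is the required \<open>f\<close>.\<close>

lemma gateaux_differentiableI_directional:
  assumes bd: "\<And>u. p u \<le> C * norm u"
    and sym: "\<And>h. directional p z h + directional p z (- h) \<le> 0"
  shows "gateaux_differentiable p z"
proof -
  let ?q = "directional p z"
  note q = sublinear_directional
  have neg: "?q (- h) = - ?q h" for h
    using sym[of h] sublinear_minus[OF q, of h] by simp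
  have add: "?q (u + v) = ?q u + ?q v" for u v
    using sublinear_add[OF q, of u v] sublinear_add[OF q, of "- u" "- v"] neg[of u] neg[of v] neg[of "u + v"]
    by simp
  have scale: "?q (c *\<^sub>R u) = c *\<^sub>R ?q u" for c u
  proof (cases "c \<ge> 0")
    case True
    then show ?thesis using sublinear_scale[OF q] by simp
  next
    case False
    then show ?thesis
      using sublinear_scale[OF q, of "- c" u] neg[of "c *\<^sub>R u"] by simp
  qed
  have "bounded_linear ?q"
  proof (rule bounded_linear_intro[OF add scale])
    fix h
    have "?q h \<le> C * norm h" "- ?q h \<le> C * norm h"
      using directional_le_self[of h] directional_le_self[of "- h"] bd[of h] bd[of "- h"] neg[of h] by auto
    then show "norm (?q h) \<le> norm h * C"
      by (simp add: mult.commute)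
  qed
  then have B: "blinfun_apply (Blinfun ?q) = ?q"
    by (rule bounded_linear_Blinfun_apply)
  have "((\<lambda>t. (p (z + t *\<^sub>R h) - p z) / t) \<longlongrightarrow> ?q h) (at 0)" for h
  proof (rule filterlim_split_at)
    \<comment> \<open>A left-hand quotient for \<open>h\<close> is the negative of a right-hand
      quotient for \<open>- h\<close>.\<close>
    have "((\<lambda>t. - ((p (z + t *\<^sub>R (- h)) - p z) / t)) \<longlongrightarrow> - ?q (- h)) (at_right 0)"
      by (intro tendsto_minus directional_tendsto)
    then show "((\<lambda>t. (p (z + t *\<^sub>R h) - p z) / t) \<longlongrightarrow> ?q h) (at_left 0)"
      unfolding filterlim_at_left_to_right neg by simp
  qed (rule directional_tendsto)
  then show ?thesis
    unfolding gateaux_differentiable_def using B by metis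
qed

end

section \<open>Touching a compact ellipsoid\<close>

text \<open>The closed unit ball of real l2, described through finite sums so that it is visibly
  closed in the product topology.\<close>

definition square_sum_ball :: "(nat \<Rightarrow> real) set" where
  "square_sum_ball = {a. \<forall>S. finite S \<longrightarrow> (\<Sum>i\<in>S. (a i)\<^sup>2) \<le> 1}"

lemma square_sum_ball_abs_le:
  assumes "a \<in> square_sum_ball"
  shows "\<bar>a i\<bar> \<le> 1"
proof -
  have "(\<Sum>i\<in>{i}. (a i)\<^sup>2) \<le> 1"
    using assms unfolding square_sum_ball_def by (metis (mono_tags) finite.emptyI finite_insert mem_Collect_eq)
  then show ?thesis by (simp add: abs_square_le_1)
qed

text \<open>A closed subset of the cube with sides \<open>{-1..1}\<close>, which is compact by
  Tychonoff's theorem.\<close>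

lemma compact_square_sum_ball: "compact square_sum_ball"
proof -
  have "compactin (product_topology (\<lambda>i. euclidean) UNIV) (PiE UNIV (\<lambda>i::nat. {-1..1::real}))"
    by (subst compactin_PiE) (simp add: compactin_euclidean_iff)
  then have "compact (PiE UNIV (\<lambda>i::nat. {-1..1::real}))"
    by (simp add: euclidean_product_topology)
  moreover have "closed square_sum_ball"
    unfolding square_sum_ball_def
    by (intro closed_Collect_all closed_Collect_imp closed_Collect_le open_Collect_const continuous_intros
        continuous_on_product_coordinates)
  moreover have "square_sum_ball \<subseteq> PiE UNIV (\<lambda>i. {-1..1})"
    using square_sum_ball_abs_le by (fastforce simp: abs_le_iff)
  ultimately show ?thesis
    by (metis compact_Int_closed inf.absorb_iff2)
qed

text \<open>Enlarging a test set \<open>S\<close> to \<open>S \<union> T\<close> brings in the whole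
  changed block, where the sum of squares does not grow.\<close>

lemma square_sum_ball_exchange:
  assumes a: "a \<in> square_sum_ball" and "finite T"
    and out: "\<And>i. i \<notin> T \<Longrightarrow> b i = a i" and T: "(\<Sum>i\<in>T. (b i)\<^sup>2) \<le> (\<Sum>i\<in>T. (a i)\<^sup>2)"
  shows "b \<in> square_sum_ball"
  unfolding square_sum_ball_def
proof (intro CollectI allI impI)
  fix S :: "nat set" assume S: "finite S"
  have split: "(\<Sum>i\<in>S \<union> T. (c i)\<^sup>2) = (\<Sum>i\<in>T. (c i)\<^sup>2) + (\<Sum>i\<in>S - T. (c i)\<^sup>2)" for c :: "nat \<Rightarrow> real"
    using S \<open>finite T\<close> by (metis Un_commute Un_Diff_cancel2 sum.union_disjoint Diff_disjoint finite_Diff)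
  have "(\<Sum>i\<in>S. (b i)\<^sup>2) \<le> (\<Sum>i\<in>S \<union> T. (b i)\<^sup>2)"
    using S \<open>finite T\<close> by (intro sum_mono2) auto
  also have "\<dots> \<le> (\<Sum>i\<in>S \<union> T. (a i)\<^sup>2)"
  proof -
    have "(\<Sum>i\<in>S - T. (b i)\<^sup>2) = (\<Sum>i\<in>S - T. (a i)\<^sup>2)"
      using out by (intro sum.cong) auto
    then show ?thesis
      unfolding split using T by simp
  qed
  also have "\<dots> \<le> 1"
    using a S \<open>finite T\<close> unfolding square_sum_ball_def by blast
  finally show "(\<Sum>i\<in>S. (b i)\<^sup>2) \<le> 1" .
qed

definition ellipsoid_point :: "(nat \<Rightarrow> 'a::banach) \<Rightarrow> (nat \<Rightarrow> real) \<Rightarrow> 'a" where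
  "ellipsoid_point x a = (\<Sum>i. a i *\<^sub>R x i)"

lemma norm_ellipsoid_term_le:
  assumes "a \<in> square_sum_ball"
  shows "norm (a i *\<^sub>R x i) \<le> norm (x i)"
  using mult_right_mono[OF square_sum_ball_abs_le[OF assms, of i], of "norm (x i)"] by simp

lemma ellipsoid_summable_norm:
  assumes "summable (\<lambda>i. norm (x i))" "a \<in> square_sum_ball"
  shows "summable (\<lambda>i. norm (a i *\<^sub>R x i))"
  by (rule summable_comparison_test[OF _ assms(1)]) (use norm_ellipsoid_term_le[OF assms(2)] in auto)

lemma norm_ellipsoid_point_le:
  assumes "summable (\<lambda>i. norm (x i))" "a \<in> square_sum_ball"
  shows "norm (ellipsoid_point x a) \<le> (\<Sum>i. norm (x i))"
proof -
  have "norm (ellipsoid_point x a) \<le> (\<Sum>i. norm (a i *\<^sub>R x i))"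
    unfolding ellipsoid_point_def by (rule summable_norm[OF ellipsoid_summable_norm[OF assms]])
  also have "\<dots> \<le> (\<Sum>i. norm (x i))"
    by (intro suminf_le ellipsoid_summable_norm norm_ellipsoid_term_le assms)
  finally show ?thesis .
qed

text \<open>The partial sums are continuous for the product topology and converge uniformly with
  majorant \<open>norm (x i)\<close>, so the image of the compact ball is norm compact.\<close>

lemma compact_ellipsoid:
  assumes "summable (\<lambda>i. norm (x i))"
  shows "compact (ellipsoid_point x ` square_sum_ball)"
proof (rule compact_continuous_image[OF _ compact_square_sum_ball])
  have "uniform_limit square_sum_ball (\<lambda>n a. \<Sum>i<n. a i *\<^sub>R x i) (ellipsoid_point x) sequentially"
    unfolding ellipsoid_point_def
    by (intro Weierstrass_m_test[OF _ assms] norm_ellipsoid_term_le)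
  moreover have "continuous_on square_sum_ball (\<lambda>a. \<Sum>i<n. a i *\<^sub>R x i)" for n
    by (intro continuous_intros continuous_on_subset[OF continuous_on_product_coordinates]) auto
  ultimately show "continuous_on square_sum_ball (ellipsoid_point x)"
    by (intro uniform_limit_theorem) auto
qed

lemma ellipsoid_point_diff:
  assumes x: "summable (\<lambda>i. norm (x i))" and "a \<in> square_sum_ball" "b \<in> square_sum_ball"
    and "finite T" "\<And>i. i \<notin> T \<Longrightarrow> b i = a i"
  shows "ellipsoid_point x a - ellipsoid_point x b = (\<Sum>i\<in>T. (a i - b i) *\<^sub>R x i)"
proof -
  have "ellipsoid_point x a - ellipsoid_point x b = (\<Sum>i. a i *\<^sub>R x i - b i *\<^sub>R x i)"
    unfolding ellipsoid_point_def
    by (intro suminf_diff) (rule summable_norm_cancel, intro ellipsoid_summable_norm assms)+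
  also have "\<dots> = (\<Sum>i. (a i - b i) *\<^sub>R x i)"
    by (simp add: scaleR_left_diff_distrib)
  also have "\<dots> = (\<Sum>i\<in>T. (a i - b i) *\<^sub>R x i)"
    using assms by (intro suminf_finite) auto
  finally show ?thesis .
qed

text \<open>The test points \<open>b\<close> below are rotations of \<open>a\<close> in the coordinates \<open>j\<close> and \<open>k\<close>, parametrised by
  \<open>s\<close> through \<open>cos = (1 - s\<^sup>2) / (1 + s\<^sup>2)\<close>, \<open>sin = 2 s / (1 + s\<^sup>2)\<close>; dividing by \<open>s\<close> and letting \<open>s \<rightarrow> 0\<close>
  gives the tangent direction.\<close>

lemma ellipsoid_support_tangent:
  assumes x: "summable (\<lambda>i. norm (x i))" and a: "a \<in> square_sum_ball"
    and q: "sublinear q" "\<And>u. q u \<le> C * norm u"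
    and touch: "\<And>b. b \<in> square_sum_ball \<Longrightarrow> q (ellipsoid_point x a - ellipsoid_point x b) \<le> 0"
  shows "q (a j *\<^sub>R x k - a k *\<^sub>R x j) \<le> 0"
proof (cases "j = k")
  case True
  then show ?thesis using sublinear_zero[OF q(1)] by simp
next
  case False
  \<comment> \<open>\<open>?t\<close> is the tangent direction of the rotation and \<open>?w\<close>
    its correction of order \<open>s\<close>: the difference of ellipsoid points is a positive
    multiple of \<open>?t + s *\<^sub>R ?w\<close>.\<close>
  let ?t = "a j *\<^sub>R x k - a k *\<^sub>R x j" and ?w = "a k *\<^sub>R x k + a j *\<^sub>R x j"
  have *: "q (?t + s *\<^sub>R ?w) \<le> 0" if "s > 0" for s
  proof -
    define d where "d = 1 + s\<^sup>2"
    have d: "d > 0" by (simp add: d_def add_pos_nonneg)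
    define b where "b = a(k := (a k * (1 - s\<^sup>2) - 2 * s * a j) / d, j := (a j * (1 - s\<^sup>2) + 2 * s * a k) / d)"
    have bk: "b k = (a k * (1 - s\<^sup>2) - 2 * s * a j) / d" and bj: "b j = (a j * (1 - s\<^sup>2) + 2 * s * a k) / d"
      using False by (auto simp: b_def)
    have "(b k)\<^sup>2 + (b j)\<^sup>2 = ((a k * (1 - s\<^sup>2) - 2 * s * a j)\<^sup>2 + (a j * (1 - s\<^sup>2) + 2 * s * a k)\<^sup>2) / d\<^sup>2"
      unfolding bk bj power_divide by (simp only: add_divide_distrib[symmetric])
    also have "\<dots> = (((a k)\<^sup>2 + (a j)\<^sup>2) * d\<^sup>2) / d\<^sup>2"
      unfolding d_def by (rule arg_cong[where f="\<lambda>v. v / _"]) algebra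
    finally have "(b k)\<^sup>2 + (b j)\<^sup>2 = (a k)\<^sup>2 + (a j)\<^sup>2"
      using d by simp
    then have b: "b \<in> square_sum_ball"
      using False by (intro square_sum_ball_exchange[OF a, of "{k, j}"]) (auto simp: b_def)
    have ak: "a k - b k = (2 * s / d) * (a j + s * a k)" and aj: "a j - b j = (2 * s / d) * (s * a j - a k)"
      unfolding bk bj using d by (simp_all add: field_simps) (simp_all add: d_def power2_eq_square algebra_simps)
    have "ellipsoid_point x a - ellipsoid_point x b = (a k - b k) *\<^sub>R x k + (a j - b j) *\<^sub>R x j"
      using ellipsoid_point_diff[OF x a b, of "{k, j}"] False by (simp add: b_def)
    also have "\<dots> = (2 * s / d) *\<^sub>R (?t + s *\<^sub>R ?w)"
      unfolding ak aj by (simp only: scaleR_add_right scaleR_diff_right scaleR_scaleR) (simp add: algebra_simps add_divide_distrib diff_divide_distrib)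
    finally have "q ((2 * s / d) *\<^sub>R (?t + s *\<^sub>R ?w)) \<le> 0"
      using touch[OF b] by simp
    then have "(2 * s / d) * q (?t + s *\<^sub>R ?w) \<le> 0"
      using sublinear_scale[OF q(1), of "2 * s / d" "?t + s *\<^sub>R ?w"] that d by simp
    moreover have "2 * s / d > 0" using that d by simp
    ultimately show ?thesis by (meson mult_pos_pos not_le)
  qed
  show ?thesis
  proof (rule tendsto_lowerbound)
    show "((\<lambda>s. s * (C * norm ?w)) \<longlongrightarrow> 0) (at_right 0)"
      by (rule tendsto_eq_intros | simp)+
    have "q ?t \<le> s * (C * norm ?w)" if "s > 0" for s
    proof -
      have "q ?t \<le> q (?t + s *\<^sub>R ?w) + q (s *\<^sub>R (- ?w))"
        using sublinear_add[OF q(1), of "?t + s *\<^sub>R ?w" "s *\<^sub>R (- ?w)"] by (simp only: scaleR_minus_right add.assoc add.right_inverse add_0_right)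
      also have "\<dots> \<le> s * q (- ?w)"
        using *[OF that] sublinear_scale[OF q(1), of s "- ?w"] that by linarith
      also have "\<dots> \<le> s * (C * norm ?w)"
        using q(2)[of "- ?w"] that by (intro mult_left_mono) (simp_all only: norm_minus_cancel less_imp_le)
      finally show ?thesis .
    qed
    then show "\<forall>\<^sub>F s in at_right 0. q ?t \<le> s * (C * norm ?w)"
      by (intro eventually_at_rightI[of 0 1]) auto
  qed simp
qed

section \<open>From vanishing on a tangent hyperplane to linearity\<close>

lemma sublinear_kernel_subspace:
  assumes q: "sublinear q"
  shows "subspace {h. q h \<le> 0 \<and> q (- h) \<le> 0}"
proof (rule subspaceI)
  fix u v assume "u \<in> {h. q h \<le> 0 \<and> q (- h) \<le> 0}" "v \<in> {h. q h \<le> 0 \<and> q (- h) \<le> 0}"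
  then show "u + v \<in> {h. q h \<le> 0 \<and> q (- h) \<le> 0}"
    using sublinear_add[OF q, of u v] sublinear_add[OF q, of "- u" "- v"] by auto
next
  fix c :: real and u assume u: "u \<in> {h. q h \<le> 0 \<and> q (- h) \<le> 0}"
  show "c *\<^sub>R u \<in> {h. q h \<le> 0 \<and> q (- h) \<le> 0}"
  proof (cases "c \<ge> 0")
    case True
    then show ?thesis
      using u sublinear_scale[OF q, of c u] sublinear_scale[OF q, of c "- u"]
      by (auto intro: mult_nonneg_nonpos)
  next
    case False
    then show ?thesis
      using u sublinear_scale[OF q, of "- c" u] sublinear_scale[OF q, of "- c" "- u"]
      by (auto intro: mult_nonneg_nonpos mult_nonpos_nonpos)
  qed
qed (use sublinear_zero[OF q] in auto)

text \<open>As \<open>q h + q (- h)\<close> is never negative, membership says that \<open>q\<close>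
  is odd at \<open>h\<close>. Differentiability amounts to this subspace being everything.\<close>

lemma sublinear_linearity_subspace:
  assumes q: "sublinear q"
  shows "subspace {h. q h + q (- h) \<le> 0}"
proof (rule subspaceI)
  fix u v assume "u \<in> {h. q h + q (- h) \<le> 0}" "v \<in> {h. q h + q (- h) \<le> 0}"
  then show "u + v \<in> {h. q h + q (- h) \<le> 0}"
    using sublinear_add[OF q, of u v] sublinear_add[OF q, of "- u" "- v"] by auto
next
  fix c :: real and u assume u: "u \<in> {h. q h + q (- h) \<le> 0}"
  show "c *\<^sub>R u \<in> {h. q h + q (- h) \<le> 0}"
  proof (cases "c \<ge> 0")
    case True
    then show ?thesis
      using u mult_left_mono[of "q u + q (- u)" 0 c]
        sublinear_scale[OF q, of c u] sublinear_scale[OF q, of c "- u"] by (simp add: algebra_simps)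
  next
    case False
    then show ?thesis
      using u mult_left_mono[of "q u + q (- u)" 0 "- c"]
        sublinear_scale[OF q, of "- c" u] sublinear_scale[OF q, of "- c" "- u"] by (simp add: algebra_simps)
  qed
qed (use sublinear_zero[OF q] in auto)

text \<open>The upper bound on \<open>q\<close> and subadditivity give a Lipschitz estimate, so
  oddness passes to norm limits.\<close>

lemma sublinear_symmetric_closure:
  assumes q: "sublinear q" "\<And>u. q u \<le> C * norm u" and D: "closure D = UNIV"
    and sym: "\<And>h. h \<in> D \<Longrightarrow> q h + q (- h) \<le> 0"
  shows "q h + q (- h) \<le> 0"
proof -
  obtain l where l: "\<And>n. l n \<in> D" "l \<longlonglongrightarrow> h"
    using D closure_sequential[of h D] by auto
  have "q h + q (- h) \<le> 2 * (C * norm (h - l n))" for n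
    using sublinear_diff[OF q(1), of h "l n"] sublinear_diff[OF q(1), of "- h" "- l n"]
      q(2)[of "h - l n"] q(2)[of "- (h - l n)"] sym[OF l(1)[of n]]
    by (simp add: norm_minus_commute)
  moreover have "(\<lambda>n. 2 * (C * norm (h - l n))) \<longlonglongrightarrow> 2 * (C * norm (h - h))"
    by (intro tendsto_intros l)
  ultimately show ?thesis
    using LIMSEQ_le_const by fastforce
qed

text \<open>Modulo the kernel of \<open>q\<close>, vectors of \<open>D\<close> are multiples of
  \<open>e\<close>, so only oddness at \<open>e\<close> is at stake. It is inherited from
  \<open>z\<close>, which is approximated by vectors of \<open>D\<close> because \<open>z\<close>
  itself may lie outside \<open>D\<close>.\<close>

lemma sublinear_linear_of_codim_one:
  assumes q: "sublinear q" "\<And>u. q u \<le> C * norm u"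
    and qz: "q z \<le> 1" "q (- z) \<le> - 1"
    and dense: "closure D = UNIV"
    and D: "\<And>h. h \<in> D \<Longrightarrow> \<exists>c. q (h - c *\<^sub>R e) \<le> 0 \<and> q (- (h - c *\<^sub>R e)) \<le> 0"
  shows "q h + q (- h) \<le> 0"
proof -
  have z0: "z \<noteq> 0" using qz sublinear_zero[OF q(1)] by auto
  have "1 \<le> q z" using qz sublinear_minus[OF q(1), of z] by linarith
  then have C: "C > 0" using q(2)[of z] z0 by (smt (verit) mult_nonneg_nonneg mult_nonpos_nonneg norm_ge_zero)
  obtain l where l: "\<And>n. l n \<in> D" "l \<longlonglongrightarrow> z"
    using dense closure_sequential[of z D] by auto
  obtain c where c: "\<And>n. q (l n - c n *\<^sub>R e) \<le> 0" "\<And>n. q (- (l n - c n *\<^sub>R e)) \<le> 0"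
    using D[OF l(1)] by metis
  define d where "d n = C * norm (z - l n)" for n
  have d: "d \<longlonglongrightarrow> 0"
  proof -
    have "d \<longlonglongrightarrow> C * norm (z - z)"
      unfolding d_def by (intro tendsto_intros l)
    then show ?thesis by simp
  qed
  have err: "q (z - l n) \<le> d n" "q (l n - z) \<le> d n" for n
    using q(2)[of "z - l n"] q(2)[of "l n - z"] by (auto simp: d_def norm_minus_commute)
  have up: "q (c n *\<^sub>R e) \<le> 1 + d n" "q (- (c n *\<^sub>R e)) \<le> - 1 + d n" for n
  proof -
    have "q (c n *\<^sub>R e) \<le> q z + q (l n - z) + q (- (l n - c n *\<^sub>R e))"
      using sublinear_add[OF q(1), of "z + (l n - z)" "- (l n - c n *\<^sub>R e)"] sublinear_add[OF q(1), of z "l n - z"] by simp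
    then show "q (c n *\<^sub>R e) \<le> 1 + d n" using err(2)[of n] c(2)[of n] qz by linarith
    have "q (- (c n *\<^sub>R e)) \<le> q (- z) + q (z - l n) + q (l n - c n *\<^sub>R e)"
      using sublinear_add[OF q(1), of "- z + (z - l n)" "l n - c n *\<^sub>R e"] sublinear_add[OF q(1), of "- z" "z - l n"] by simp
    then show "q (- (c n *\<^sub>R e)) \<le> - 1 + d n" using err(1)[of n] c(1)[of n] qz by linarith
  qed
  \<comment> \<open>The failure of oddness at \<open>e\<close>. By \<open>cg\<close>, the product of
    \<open>g\<close> with the coefficients \<open>c n\<close> tends to zero, while
    \<open>low\<close> keeps these coefficients away from zero; hence
    \<open>g \<le> 0\<close>.\<close>
  define g where "g = q e + q (- e)"
  have g0: "g \<ge> 0" using sublinear_minus[OF q(1)] by (simp add: g_def)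
  have cg: "\<bar>c n\<bar> * g \<le> 2 * d n" for n
  proof (cases "c n \<ge> 0")
    case True
    then have "\<bar>c n\<bar> * g = q (c n *\<^sub>R e) + q (- (c n *\<^sub>R e))"
      using sublinear_scale[OF q(1), of "c n" e] sublinear_scale[OF q(1), of "c n" "- e"] by (simp add: g_def algebra_simps)
    then show ?thesis using up[of n] by linarith
  next
    case False
    then have "\<bar>c n\<bar> * g = q (c n *\<^sub>R e) + q (- (c n *\<^sub>R e))"
      using sublinear_scale[OF q(1), of "- c n" e] sublinear_scale[OF q(1), of "- c n" "- e"] by (simp add: g_def algebra_simps)
    then show ?thesis using up[of n] by linarith
  qed
  have low: "1 - d n \<le> C * (\<bar>c n\<bar> * norm e)" for n
    using sublinear_minus[OF q(1), of "c n *\<^sub>R e"] up(2)[of n] q(2)[of "c n *\<^sub>R e"] by simp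
  have "(1 - d n) * g \<le> C * norm e * (2 * d n)" for n
  proof -
    have "(1 - d n) * g \<le> C * (\<bar>c n\<bar> * norm e) * g"
      by (rule mult_right_mono[OF low g0])
    also have "\<dots> = C * norm e * (\<bar>c n\<bar> * g)" by simp
    also have "\<dots> \<le> C * norm e * (2 * d n)"
      using C by (intro mult_left_mono cg) auto
    finally show ?thesis .
  qed
  moreover have "(\<lambda>n. (1 - d n) * g) \<longlonglongrightarrow> (1 - 0) * g" "(\<lambda>n. C * norm e * (2 * d n)) \<longlonglongrightarrow> C * norm e * (2 * 0)"
    by (intro tendsto_intros d)+
  ultimately have "g \<le> 0"
    using LIMSEQ_le by fastforce
  have eL: "e \<in> {h. q h + q (- h) \<le> 0}" using \<open>g \<le> 0\<close> by (simp add: g_def)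
  have "k \<in> {h. q h + q (- h) \<le> 0}" if "k \<in> D" for k
  proof -
    obtain c where "q (k - c *\<^sub>R e) \<le> 0" "q (- (k - c *\<^sub>R e)) \<le> 0" using D \<open>k \<in> D\<close> by blast
    then have "k - c *\<^sub>R e \<in> {h. q h + q (- h) \<le> 0}" by simp
    then have "(k - c *\<^sub>R e) + c *\<^sub>R e \<in> {h. q h + q (- h) \<le> 0}"
      using eL by (intro subspace_add subspace_scale sublinear_linearity_subspace[OF q(1)])
    then show ?thesis by simp
  qed
  then show ?thesis
    using sublinear_symmetric_closure[OF q dense] by blast
qed

text \<open>By \<open>touch\<close>, a translate of the ellipsoid lies in
  \<open>{u. p u \<le> 1}\<close> and meets its boundary at \<open>z\<close>. The derivative of
  \<open>p\<close> then vanishes on the tangent directions at the parameter \<open>a\<close>, and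
  modulo these every \<open>x j\<close> is a multiple of one \<open>x k\<close>.\<close>

lemma gateaux_differentiable_ellipsoid_touch:
  fixes p :: "'a::banach \<Rightarrow> real"
  assumes p: "sublinear p" "\<And>u. p u \<le> C * norm u" and pz: "p z = 1"
    and x: "summable (\<lambda>i. norm (x i))" and dense: "closure (span (range x)) = UNIV"
    and a: "a \<in> square_sum_ball"
    and touch: "\<And>b. b \<in> square_sum_ball \<Longrightarrow> p (z + (ellipsoid_point x a - ellipsoid_point x b)) \<le> 1"
  shows "gateaux_differentiable p z"
proof (rule gateaux_differentiableI_directional[OF p])
  fix h
  let ?q = "directional p z"
  note q = sublinear_directional[OF p(1), of z]
  have qC: "?q u \<le> C * norm u" for u
    using directional_le_self[OF p(1), of z u] p(2)[of u] by linarith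
  have qz: "?q z \<le> 1" "?q (- z) \<le> - 1"
    using directional_le_self[OF p(1), of z z] directional_minus_self[OF p(1), of z] pz by auto
  have qt: "?q (ellipsoid_point x a - ellipsoid_point x b) \<le> 0" if "b \<in> square_sum_ball" for b
    using directional_le[OF p(1), of 1 z "ellipsoid_point x a - ellipsoid_point x b"] touch[OF that] pz by simp
  let ?N = "{h. ?q h \<le> 0 \<and> ?q (- h) \<le> 0}"
  have tangent: "a j *\<^sub>R x k - a k *\<^sub>R x j \<in> ?N" for j k
    using ellipsoid_support_tangent[OF x a q qC qt, of j k] ellipsoid_support_tangent[OF x a q qC qt, of k j] by simp
  \<comment> \<open>Were \<open>a\<close> the centre of the ball, both \<open>x k\<close> and
    \<open>- x k\<close> would be admissible differences. The derivative would be at most zero on a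
    dense span, against its value of at least 1 at \<open>z\<close>.\<close>
  have "\<exists>k. a k \<noteq> 0"
  proof (rule ccontr)
    assume "\<not> (\<exists>k. a k \<noteq> 0)"
    then have a0: "a k = 0" for k by blast
    have "s *\<^sub>R x k \<in> {h. ?q h \<le> 0}" if "s \<in> {1, -1}" for s k
    proof -
      define b where "b = (\<lambda>i. if i = k then - s else 0)"
      have "(\<Sum>i\<in>S. (b i)\<^sup>2) \<le> 1" if "finite S" for S
      proof -
        have "(\<Sum>i\<in>S. (b i)\<^sup>2) = (\<Sum>i\<in>S. if i = k then 1 else 0)"
          using \<open>s \<in> {1, -1}\<close> by (intro sum.cong) (auto simp: b_def)
        then show ?thesis using \<open>finite S\<close> by simp
      qed
      then have b: "b \<in> square_sum_ball" by (simp add: square_sum_ball_def)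
      have "ellipsoid_point x a - ellipsoid_point x b = s *\<^sub>R x k"
        using ellipsoid_point_diff[OF x a b, of "{k}"] by (simp add: a0 b_def)
      then show ?thesis using qt[OF b] by simp
    qed
    from this[of 1] this[of "-1"] have "range x \<subseteq> ?N" by auto
    then have span_N: "span (range x) \<subseteq> ?N"
      using sublinear_kernel_subspace[OF q] by (intro span_minimal)
    obtain l where l: "\<And>n. l n \<in> span (range x)" "l \<longlonglongrightarrow> z"
      using dense closure_sequential[of z "span (range x)"] by auto
    have "1 \<le> C * norm (z - l n)" for n
    proof -
      have "?q (l n) \<le> 0" using l(1) span_N by blast
      moreover have "1 \<le> ?q z" using qz sublinear_minus[OF q, of z] by linarith
      ultimately show ?thesis
        using sublinear_diff[OF q, of z "l n"] qC[of "z - l n"] by linarith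
    qed
    moreover have "(\<lambda>n. C * norm (z - l n)) \<longlonglongrightarrow> C * norm (z - z)"
      by (intro tendsto_intros l)
    ultimately have "1 \<le> C * norm (z - z)"
      using LIMSEQ_le_const by blast
    then show False by simp
  qed
  then obtain k where k: "a k \<noteq> 0" by blast
  have N: "subspace ?N" by (rule sublinear_kernel_subspace[OF q])
  define L where "L = {h. \<exists>c. h - c *\<^sub>R x k \<in> ?N}"
  have "subspace L"
  proof (rule subspaceI)
    show "0 \<in> L" using subspace_0[OF N] unfolding L_def by (auto intro!: exI[of _ 0])
  next
    fix u v assume "u \<in> L" "v \<in> L"
    then obtain c d where "u - c *\<^sub>R x k \<in> ?N" "v - d *\<^sub>R x k \<in> ?N" by (auto simp only: L_def mem_Collect_eq)
    from subspace_add[OF N this] show "u + v \<in> L"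
      unfolding L_def by (intro CollectI exI[of _ "c + d"]) (simp add: algebra_simps)
  next
    fix r u assume "u \<in> L"
    then obtain c where "u - c *\<^sub>R x k \<in> ?N" by (auto simp only: L_def mem_Collect_eq)
    from subspace_scale[OF N this, of r] show "r *\<^sub>R u \<in> L"
      unfolding L_def by (intro CollectI exI[of _ "r * c"]) (simp add: algebra_simps)
  qed
  moreover have "x j \<in> L" for j
  proof -
    \<comment> \<open>Dividing the tangent vector by \<open>- a k\<close> solves it for
      \<open>x j\<close> modulo \<open>?N\<close>.\<close>
    have "(- 1 / a k) *\<^sub>R (a j *\<^sub>R x k - a k *\<^sub>R x j) \<in> ?N"
      by (rule subspace_scale[OF N tangent])
    moreover have "(- 1 / a k) *\<^sub>R (a j *\<^sub>R x k - a k *\<^sub>R x j) = x j - (a j / a k) *\<^sub>R x k"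
      using k by (simp add: algebra_simps)
    ultimately have "x j - (a j / a k) *\<^sub>R x k \<in> ?N" by (simp only:)
    then show ?thesis unfolding L_def by - (rule CollectI, rule exI, assumption)
  qed
  ultimately have "span (range x) \<subseteq> L" by (intro span_minimal) auto
  then show "?q h + ?q (- h) \<le> 0"
    by (intro sublinear_linear_of_codim_one[OF q qC qz dense, of "x k"]) (auto simp: L_def)
qed

section \<open>Gauges, smooth points and exposed points\<close>

lemma small_multipleE:
  fixes w :: "'a::real_normed_vector" and d :: real
  assumes "d > 0"
  obtains c where "c > 0" "c * norm w < d"
proof
  let ?c = "d / (norm w + 1)"
  show "?c > 0" using assms by (simp add: add_nonneg_pos)
  then have "?c * norm w < ?c * (norm w + 1)" by (intro mult_strict_left_mono) auto
  also have "\<dots> = d" using norm_ge_zero[of w] by (simp add: add_nonneg_eq_0_iff)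
  finally show "?c * norm w < d" .
qed

context
  fixes C :: "'a::real_normed_vector set" and r :: real
  assumes C: "convex C" and r: "r > 0" "ball 0 r \<subseteq> C"
begin

lemma minkowski_functional_eq: "minkowski_functional C x = Inf {t. t > 0 \<and> (1/t) *\<^sub>R x \<in> C}"
proof -
  have "x \<in> (*\<^sub>R) t ` C \<longleftrightarrow> (1/t) *\<^sub>R x \<in> C" if "t > 0" for t
  proof
    assume "(1/t) *\<^sub>R x \<in> C"
    then show "x \<in> (*\<^sub>R) t ` C"
      using that by (intro image_eqI[of _ _ "(1/t) *\<^sub>R x"]) auto
  qed (use that in auto)
  then show ?thesis
    unfolding minkowski_functional_def by (metis (no_types, lifting))
qed

lemma minkowski_functional_le: "t > 0 \<Longrightarrow> (1/t) *\<^sub>R x \<in> C \<Longrightarrow> minkowski_functional C x \<le> t"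
  unfolding minkowski_functional_eq by (intro cInf_lower bdd_belowI[of _ 0]) auto

lemma minkowski_functional_le_norm: "minkowski_functional C x \<le> (1/r) * norm x"
proof (rule dense_ge)
  fix t assume t: "(1/r) * norm x < t"
  then have "0 < t" using r(1) by (smt (verit) mult_nonneg_nonneg norm_ge_zero zero_le_divide_1_iff)
  then have "(1/t) *\<^sub>R x \<in> ball 0 r"
    using t r(1) by (simp add: field_simps)
  then show "minkowski_functional C x \<le> t"
    using r(2) \<open>0 < t\<close> by (intro minkowski_functional_le) auto
qed

text \<open>An admissible \<open>s < t\<close> exists because the infimum is below \<open>t\<close>.
  Since \<open>C\<close> is convex and contains 0, admissibility passes from \<open>s\<close> to the
  larger \<open>t\<close>.\<close>

lemma minkowski_functional_less:
  assumes "minkowski_functional C x < t"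
  shows "t > 0 \<and> (1/t) *\<^sub>R x \<in> C"
proof -
  have "(1 / (norm x / r + 1)) *\<^sub>R x \<in> ball 0 r"
    using r(1) by (simp add: field_simps add_pos_nonneg)
  moreover have "norm x / r + 1 > 0" using r(1) by (simp add: add_nonneg_pos)
  ultimately have "{t. t > 0 \<and> (1/t) *\<^sub>R x \<in> C} \<noteq> {}"
    using r(2) by blast
  then obtain s where s: "s > 0" "(1/s) *\<^sub>R x \<in> C" "s < t"
    using cInf_lessD[of "{t. t > 0 \<and> (1/t) *\<^sub>R x \<in> C}" t] assms unfolding minkowski_functional_eq by auto
  have "0 \<in> C" using r by auto
  then have "(s/t) *\<^sub>R ((1/s) *\<^sub>R x) + (1 - s/t) *\<^sub>R 0 \<in> C"
    using s by (intro convexD[OF C]) auto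
  then show ?thesis using s by simp
qed

lemma minkowski_functional_nonneg: "0 \<le> minkowski_functional C x"
  using minkowski_functional_less[of x 0] by force

lemma sublinear_minkowski_functional: "sublinear (minkowski_functional C)"
  unfolding sublinear_def
proof (intro conjI allI impI)
  let ?p = "minkowski_functional C"
  fix u v
  show "?p (u + v) \<le> ?p u + ?p v"
  proof (rule field_le_epsilon)
    fix e :: real assume "e > 0"
    define s where "s = ?p u + e/2"
    define t where "t = ?p v + e/2"
    have s: "s > 0" "(1/s) *\<^sub>R u \<in> C" and t: "t > 0" "(1/t) *\<^sub>R v \<in> C"
      using minkowski_functional_less[of u s] minkowski_functional_less[of v t] \<open>e > 0\<close>
      by (auto simp: s_def t_def)
    have "(s/(s+t)) *\<^sub>R ((1/s) *\<^sub>R u) + (t/(s+t)) *\<^sub>R ((1/t) *\<^sub>R v) \<in> C"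
      using s t by (intro convexD[OF C]) (auto simp flip: add_divide_distrib)
    then have "(1/(s+t)) *\<^sub>R (u + v) \<in> C"
      using s t by (simp add: scaleR_add_right)
    then show "?p (u + v) \<le> ?p u + ?p v + e"
      using minkowski_functional_le[of "s + t" "u + v"] s t by (simp add: s_def t_def)
  qed
next
  let ?p = "minkowski_functional C"
  fix c :: real and u assume c: "c \<ge> 0"
  have le: "?p (d *\<^sub>R w) \<le> d * ?p w" if d: "d > 0" for d w
  proof (rule field_le_epsilon)
    fix e :: real assume "e > 0"
    then have t: "?p w + e/d > 0" "(1 / (?p w + e/d)) *\<^sub>R w \<in> C"
      using minkowski_functional_less[of w "?p w + e/d"] d by auto
    have "?p (d *\<^sub>R w) \<le> d * (?p w + e/d)"
      using t d by (intro minkowski_functional_le) auto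
    then show "?p (d *\<^sub>R w) \<le> d * ?p w + e"
      using d by (simp add: algebra_simps)
  qed
  show "?p (c *\<^sub>R u) = c * ?p u"
  proof (cases "c = 0")
    case True
    then show ?thesis
      using minkowski_functional_le_norm[of 0] minkowski_functional_nonneg[of 0] by simp
  next
    case False
    then have "?p u \<le> (1/c) * ?p (c *\<^sub>R u)"
      using le[of "1/c" "c *\<^sub>R u"] c by simp
    then have "c * ?p u \<le> ?p (c *\<^sub>R u)"
      using False c by (simp add: field_simps)
    then show ?thesis using le[of c u] False c by simp
  qed
qed

text \<open>If \<open>x\<close> is \<open>t\<close> times a point of \<open>C\<close> with
  \<open>t < 1\<close>, the spare weight \<open>1 - t\<close> placed on \<open>ball 0 r\<close>
  gives a ball around \<open>x\<close> inside \<open>C\<close>.\<close>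

lemma minkowski_functional_less_one_interior:
  assumes "minkowski_functional C x < 1"
  shows "x \<in> interior C"
proof -
  obtain t where t: "minkowski_functional C x < t" "t < 1"
    using assms dense by blast
  have x: "t > 0" "(1/t) *\<^sub>R x \<in> C"
    using minkowski_functional_less[OF t(1)] by auto
  have "ball x ((1 - t) * r) \<subseteq> C"
  proof
    fix y assume "y \<in> ball x ((1 - t) * r)"
    then have "norm (y - x) / (1 - t) < r"
      using t by (simp add: dist_norm norm_minus_commute pos_divide_less_eq mult.commute)
    then have "(1 / (1 - t)) *\<^sub>R (y - x) \<in> ball 0 r"
      using t by (simp only: mem_ball_0 norm_scaleR) simp
    then have "t *\<^sub>R ((1/t) *\<^sub>R x) + (1 - t) *\<^sub>R ((1 / (1 - t)) *\<^sub>R (y - x)) \<in> C"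
      using x t r(2) by (intro convexD[OF C]) auto
    then show "y \<in> C" using x t by simp
  qed
  moreover have "(1 - t) * r > 0" using t r by simp
  ultimately show ?thesis
    unfolding mem_interior by blast
qed

lemma minkowski_functional_dominates:
  assumes "m > 0" "\<And>x. x \<in> C \<Longrightarrow> blinfun_apply g x \<le> m"
  shows "blinfun_apply g h \<le> m * minkowski_functional C h"
proof (rule field_le_epsilon)
  fix e :: real assume "e > 0"
  let ?t = "minkowski_functional C h + e/m"
  have t: "?t > 0" "(1 / ?t) *\<^sub>R h \<in> C"
    using minkowski_functional_less[of h ?t] \<open>e > 0\<close> assms(1) by auto
  have "blinfun_apply g ((1 / ?t) *\<^sub>R h) \<le> m"
    by (rule assms(2)[OF t(2)])
  then have "blinfun_apply g h \<le> m * ?t"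
    using t(1) by (simp add: blinfun.scaleR_right field_simps del: divide_add_eq_iff add_divide_eq_iff)
  then show "blinfun_apply g h \<le> m * minkowski_functional C h + e"
    using assms(1) by (simp add: algebra_simps)
qed

end

text \<open>An interior point \<open>z\<close> of the closure lies strictly between some
  \<open>a\<close> in \<open>G\<close> and a point \<open>w\<close> of the closure. Approximating
  \<open>w\<close> from \<open>G\<close> and correcting \<open>a\<close> exhibits \<open>z\<close>
  as a convex combination of points of \<open>G\<close>.\<close>

lemma interior_closure_convex_open:
  fixes G :: "'a::real_normed_vector set"
  assumes "convex G" "open G"
  shows "interior (closure G) = G"
proof
  show "interior (closure G) \<subseteq> G"
  proof
    fix z assume z: "z \<in> interior (closure G)"
    then obtain a where a: "a \<in> G"
      using interior_subset by fastforce
    obtain d where d: "d > 0" "ball a d \<subseteq> G"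
      using a \<open>open G\<close> open_contains_ball by blast
    obtain s where s: "s > 0" "ball z s \<subseteq> closure G"
      using z mem_interior by blast
    obtain e where e: "e > 0" "e * norm (z - a) < s"
      using small_multipleE[OF s(1)] .
    define w where "w = z + e *\<^sub>R (z - a)"
    have "w \<in> ball z s" using e by (simp add: w_def dist_norm)
    then have "w \<in> closure G" using s by blast
    then obtain w' where w': "w' \<in> G" "dist w' w < d * e"
      using d e closure_approachable[of w G] by (meson mult_pos_pos)
    \<comment> \<open>The correction cancels the error \<open>w - w'\<close>, so that
      \<open>w' + e *\<^sub>R a' = (1 + e) *\<^sub>R z\<close>; the tolerance \<open>d * e\<close>
      keeps \<open>a'\<close> in \<open>ball a d\<close>.\<close>
    define a' where "a' = a + (1/e) *\<^sub>R (w - w')"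
    have "norm ((1/e) *\<^sub>R (w - w')) < d"
    proof -
      have "norm (w - w') / e < d"
        using w'(2) e by (simp add: dist_norm norm_minus_commute pos_divide_less_eq)
      then show ?thesis using e by (simp only: norm_scaleR) simp
    qed
    then have "a' \<in> G" using d by (auto simp: a'_def dist_norm)
    have "(1 / (1 + e)) *\<^sub>R w' + (e / (1 + e)) *\<^sub>R a' \<in> G"
      using e w'(1) \<open>a' \<in> G\<close> by (intro convexD[OF \<open>convex G\<close>]) (auto simp flip: add_divide_distrib)
    moreover have "(1 / (1 + e)) *\<^sub>R w' + (e / (1 + e)) *\<^sub>R a' = (1 / (1 + e)) *\<^sub>R (w' + e *\<^sub>R a')"
      by (simp add: scaleR_add_right)
    moreover have "w' + e *\<^sub>R a' = (1 + e) *\<^sub>R z"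
      using e by (simp add: a'_def w_def algebra_simps)
    ultimately show "z \<in> G" using e by simp
  qed
next
  show "G \<subseteq> interior (closure G)"
    by (intro interior_maximal closure_subset assms)
qed

lemma gauge_body:
  fixes G :: "'a::real_normed_vector set" and a :: 'a
  assumes "convex G" "open G" and a: "a \<in> interior (closure G)"
  obtains r :: real where "r > 0" "convex ((\<lambda>y. y - a) ` closure G)" "ball 0 r \<subseteq> (\<lambda>y. y - a) ` closure G"
proof -
  obtain r where r: "r > 0" "ball a r \<subseteq> closure G"
    using a mem_interior by blast
  have "ball 0 r \<subseteq> (\<lambda>y. y - a) ` closure G"
  proof
    fix u :: 'a assume "u \<in> ball 0 r"
    then have "u + a \<in> closure G" using r by (auto simp: dist_norm)
    then show "u \<in> (\<lambda>y. y - a) ` closure G" by (intro image_eqI[of _ _ "u + a"]) auto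
  qed
  then show ?thesis
    using that r \<open>convex G\<close> by (simp add: convex_closure convex_translation_subtract)
qed

lemma gauge_frontier:
  fixes G :: "'a::real_normed_vector set"
  assumes G: "convex G" "open G" and a: "a \<in> interior (closure G)" and z: "z \<in> frontier (closure G)"
  shows "minkowski_functional ((\<lambda>y. y - a) ` closure G) (z - a) = 1"
proof -
  obtain r where r: "r > 0" "convex ((\<lambda>y. y - a) ` closure G)" "ball 0 r \<subseteq> (\<lambda>y. y - a) ` closure G"
    using gauge_body[OF G a] .
  have "minkowski_functional ((\<lambda>y. y - a) ` closure G) (z - a) \<le> 1"
    using z by (intro minkowski_functional_le[OF r(2,1,3)]) (auto simp: frontier_def)
  moreover have "z - a \<notin> interior ((\<lambda>y. y - a) ` closure G)"
    using z by (auto simp: frontier_def interior_translation_subtract)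
  ultimately show ?thesis
    using minkowski_functional_less_one_interior[OF r(2,1,3), of "z - a"] by force
qed

text \<open>The gauge is centred at an arbitrary interior point \<open>a\<close>, the polar at 0.
  The derivative \<open>f\<close> of the gauge supports \<open>closure G\<close> at
  \<open>z\<close>; divided by \<open>f z\<close> it is exposed by \<open>z\<close>, since any
  competitor equal to 1 at \<open>z\<close> is a multiple of \<open>f\<close>.\<close>

lemma smooth_point_closureD:
  fixes G :: "'a::real_normed_vector set"
  assumes G: "convex G" "open G" "0 \<in> G" and z: "smooth_point (closure G) z"
  obtains f where "f \<in> wstar_exposed (polar G)" "blinfun_apply f z = 1"
proof -
  obtain a where a: "a \<in> interior (closure G)"
    and gat: "gateaux_differentiable (minkowski_functional ((\<lambda>y. y - a) ` closure G)) (z - a)"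
    and zf: "z \<in> frontier (closure G)"
    using z unfolding smooth_point_def by blast
  let ?C = "(\<lambda>y. y - a) ` closure G"
  let ?p = "minkowski_functional ?C"
  define w where "w = z - a"
  have zcl: "z \<in> closure G" using zf by (simp add: frontier_def)
  obtain r where r: "r > 0" "convex ?C" "ball 0 r \<subseteq> ?C"
    using gauge_body[OF G(1,2) a] .
  note p = sublinear_minkowski_functional[OF r(2,1,3)]
  have pw: "?p w = 1" unfolding w_def by (rule gauge_frontier[OF G(1,2) a zf])
  obtain f where f: "\<And>h. ((\<lambda>t. (?p (w + t *\<^sub>R h) - ?p w) / t) \<longlongrightarrow> blinfun_apply f h) (at 0)"
    using gat unfolding gateaux_differentiable_def w_def by blast
  have fR: "((\<lambda>t. (?p (w + t *\<^sub>R h) - 1) / t) \<longlongrightarrow> blinfun_apply f h) (at_right 0)" for h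
    using f[of h] unfolding pw by (rule filterlim_mono) (auto simp: at_le)
  have f_le: "blinfun_apply f h \<le> ?p h" for h
  proof (rule tendsto_upperbound[OF fR])
    have "(?p (w + t *\<^sub>R h) - 1) / t \<le> ?p h" if "t > 0" for t
      using sublinear_add[OF p, of w "t *\<^sub>R h"] sublinear_scale[OF p, of t h] that pw
      by (simp add: field_simps)
    then show "\<forall>\<^sub>F t in at_right 0. (?p (w + t *\<^sub>R h) - 1) / t \<le> ?p h"
      by (intro eventually_at_rightI[of 0 1]) auto
  qed simp
  have fw: "blinfun_apply f w = 1"
  proof (rule tendsto_unique[OF _ fR])
    have "(?p (w + t *\<^sub>R w) - 1) / t = 1" if "t > 0" for t
      using sublinear_scale[OF p, of "1 + t" w] that pw by (simp add: algebra_simps)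
    then have "\<forall>\<^sub>F t in at_right 0. 1 = (?p (w + t *\<^sub>R w) - 1) / t"
      by (intro eventually_at_rightI[of 0 1]) auto
    then show "((\<lambda>t. (?p (w + t *\<^sub>R w) - 1) / t) \<longlongrightarrow> 1) (at_right 0)"
      by (rule Lim_transform_eventually[OF tendsto_const])
  qed simp
  have f_max: "blinfun_apply f x \<le> blinfun_apply f z" if "x \<in> closure G" for x
  proof -
    have "?p (x - a) \<le> 1"
      using that by (intro minkowski_functional_le[OF r(2,1,3)]) auto
    then have "blinfun_apply f (x - a) \<le> blinfun_apply f w"
      using f_le[of "x - a"] fw by linarith
    then show ?thesis by (simp add: w_def blinfun.diff_right)
  qed
  \<comment> \<open>A small multiple of \<open>w\<close> lies in \<open>G\<close>, where
    \<open>f\<close> is positive, and \<open>f\<close> is largest at \<open>z\<close>.\<close>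
  have fz: "blinfun_apply f z > 0"
  proof -
    obtain d where d: "d > 0" "ball 0 d \<subseteq> G"
      using G open_contains_ball by blast
    obtain c where c: "c > 0" "c * norm w < d"
      using small_multipleE[OF d(1)] .
    then have "c *\<^sub>R w \<in> closure G" using d closure_subset by fastforce
    then show ?thesis using f_max[of "c *\<^sub>R w"] fw c by (simp add: blinfun.scaleR_right)
  qed
  define F where "F = (1 / blinfun_apply f z) *\<^sub>R f"
  have Fz: "blinfun_apply F z = 1" using fz by (simp add: F_def blinfun.scaleR_left)
  have "F \<in> polar G"
    using f_max fz closure_subset unfolding polar_def F_def
    by (force simp: blinfun.scaleR_left field_simps)
  moreover have "blinfun_apply g z < blinfun_apply F z" if g: "g \<in> polar G" "g \<noteq> F" for g
  proof (rule ccontr)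
    have "G \<subseteq> {x. blinfun_apply g x \<le> 1}" using g by (auto simp: polar_def)
    moreover have "closed {x. blinfun_apply g x \<le> 1}"
      by (intro closed_Collect_le continuous_intros)
    ultimately have g_le: "blinfun_apply g x \<le> 1" if "x \<in> closure G" for x
      using that closure_minimal by blast
    assume "\<not> blinfun_apply g z < blinfun_apply F z"
    then have gz: "blinfun_apply g z = 1" using g_le[OF zcl] Fz by linarith
    \<comment> \<open>An upper bound for \<open>g\<close> on the translated body, attained at
      \<open>w\<close>. Thus \<open>g / m\<close> lies below the gauge and agrees with it at
      \<open>w\<close>.\<close>
    define m where "m = 1 - blinfun_apply g a"
    have "m > 0"
    proof -
      obtain d where d: "d > 0" "ball a d \<subseteq> closure G"
        using a mem_interior by blast
      obtain c where c: "c > 0" "c * norm z < d"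
        using small_multipleE[OF d(1)] .
      then have "a + c *\<^sub>R z \<in> closure G" using d by (auto simp: dist_norm)
      then show ?thesis
        using g_le[of "a + c *\<^sub>R z"] gz c by (simp add: m_def blinfun.add_right blinfun.scaleR_right)
    qed
    have g_dom: "blinfun_apply g h \<le> m * ?p h" for h
      using \<open>m > 0\<close> g_le by (intro minkowski_functional_dominates[OF r(2,1,3)]) (auto simp: m_def blinfun.diff_right)
    have gw: "blinfun_apply g w = m" by (simp add: w_def m_def gz blinfun.diff_right)
    have le: "blinfun_apply g h / m \<le> blinfun_apply f h" for h
    proof (rule tendsto_lowerbound[OF fR])
      have "blinfun_apply g h / m \<le> (?p (w + t *\<^sub>R h) - 1) / t" if "t > 0" for t
        using g_dom[of "w + t *\<^sub>R h"] gw that \<open>m > 0\<close>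
        by (simp add: blinfun.add_right blinfun.scaleR_right field_simps)
      then show "\<forall>\<^sub>F t in at_right 0. blinfun_apply g h / m \<le> (?p (w + t *\<^sub>R h) - 1) / t"
        by (intro eventually_at_rightI[of 0 1]) auto
    qed simp
    \<comment> \<open>One linear functional below another, tested at \<open>h\<close> and
      \<open>- h\<close>, must equal it.\<close>
    have eq: "blinfun_apply g h = m * blinfun_apply f h" for h
      using le[of h] le[of "- h"] \<open>m > 0\<close> by (simp add: blinfun.minus_right field_simps)
    then have "m * blinfun_apply f z = 1" using gz by metis
    then have "g = F"
      using fz eq by (intro blinfun_eqI) (simp add: F_def blinfun.scaleR_left field_simps)
    then show False using g by simp
  qed
  ultimately have "F \<in> wstar_exposed (polar G)"
    unfolding wstar_exposed_def by blast
  then show ?thesis using that Fz by blast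
qed

section \<open>Smooth boundary points outside countably many weakly closed sets\<close>

lemma separable_small_dense_directions:
  assumes "separable_space (euclidean :: 'a::real_normed_vector topology)" "r > 0"
  obtains x :: "nat \<Rightarrow> 'a::real_normed_vector" where "summable (\<lambda>i. norm (x i))" "(\<Sum>i. norm (x i)) < r" "closure (span (range x)) = UNIV"
proof -
  obtain D :: "'a set" where D: "countable D" "closure D = UNIV"
    using assms(1) unfolding separable_space_def by auto
  then have "D \<noteq> {}" by auto
  define e where "e = from_nat_into D"
  have e: "range e = D" unfolding e_def by (rule range_from_nat_into[OF \<open>D \<noteq> {}\<close> D(1)])
  \<comment> \<open>Positive factors leave the span of the dense sequence unchanged; the geometric
    decay bounds the sum of norms by \<open>r / 2\<close>.\<close>
  define c where "c i = r / 4 * (1/2)^i / (1 + norm (e i))" for i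
  have c: "c i > 0" for i using assms(2) by (simp add: c_def add_pos_nonneg)
  define x where "x i = c i *\<^sub>R e i" for i
  have nx: "norm (x i) \<le> r / 4 * (1/2)^i" for i
  proof -
    have "norm (x i) = r / 4 * (1/2)^i * (norm (e i) / (1 + norm (e i)))"
      using c[of i] by (simp add: x_def) (simp add: c_def)
    also have "\<dots> \<le> r / 4 * (1/2)^i * 1"
      using assms(2) by (intro mult_left_mono) (auto simp: divide_le_eq_1 add_pos_nonneg)
    finally show ?thesis by simp
  qed
  have sums: "(\<lambda>i. r / 4 * (1/2)^i) sums (r / 4 * 2)"
    using geometric_sums[of "1/2::real"] by (intro sums_mult) simp
  have sx: "summable (\<lambda>i. norm (x i))"
    by (rule summable_comparison_test[OF _ sums_summable[OF sums]]) (use nx in auto)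
  have "(\<Sum>i. norm (x i)) \<le> (\<Sum>i. r / 4 * (1/2)^i)"
    by (rule suminf_le[OF nx sx sums_summable[OF sums]])
  also have "\<dots> < r"
    using sums_unique[OF sums] assms(2) by simp
  finally have "(\<Sum>i. norm (x i)) < r" .
  moreover have "D \<subseteq> span (range x)"
  proof -
    have "(1 / c i) *\<^sub>R x i \<in> span (range x)" for i
      by (intro span_scale span_base) auto
    moreover have "(1 / c i) *\<^sub>R x i = e i" for i using c[of i] by (simp add: x_def)
    ultimately show ?thesis using e by auto
  qed
  then have "closure (span (range x)) = UNIV"
    using D(2) closure_mono by blast
  ultimately show ?thesis using that sx by blast
qed

text \<open>The boundary lemma for the eroded sets yields \<open>y\<close> such that
  \<open>y - k\<close> lies in \<open>closure G\<close> and in no \<open>F n\<close> for every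
  \<open>k\<close> in \<open>E\<close>, while some \<open>y - k\<close> is outside \<open>G\<close>.
  There the reflected ellipsoid touches the boundary from inside, which forces smoothness.\<close>

lemma class_K_smooth_points_not_covered:
  fixes G :: "'a::banach set"
  assumes K: "class_K TYPE('a)" and sep: "separable_space (euclidean :: 'a topology)"
    and G: "G \<noteq> {}" "convex G" "bounded G" "open G"
    and F: "\<And>n::nat. closedin weak_topology (F n)" "G \<inter> (\<Union>n. F n) = {}"
  obtains z where "smooth_point (closure G) z" "z \<notin> (\<Union>n. F n)"
proof -
  obtain a where a: "a \<in> G" using G by blast
  obtain r where r: "r > 0" "ball a r \<subseteq> G" using a G open_contains_ball by blast
  obtain x :: "nat \<Rightarrow> 'a" where x: "summable (\<lambda>i. norm (x i))" "(\<Sum>i. norm (x i)) < r"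
      "closure (span (range x)) = UNIV"
    using separable_small_dense_directions[OF sep r(1)] .
  define E where "E = ellipsoid_point x ` square_sum_ball"
  have E: "compact E" unfolding E_def by (rule compact_ellipsoid[OF x(1)])
  define G' where "G' = {y. \<forall>k\<in>E. y - k \<in> G}"
  have "open G'"
  proof -
    \<comment> \<open>The complement of the erosion is the sum of a closed and a compact set, hence
      closed.\<close>
    have "- G' = (\<Union>u\<in>- G. \<Union>k\<in>E. {u + k})"
      by (force simp: G'_def algebra_simps)
    moreover have "closed (\<Union>u\<in>- G. \<Union>k\<in>E. {u + k})"
      using G(4) by (intro closed_compact_sums E) (simp add: closed_def)
    ultimately show ?thesis by (simp add: open_closed)
  qed
  \<comment> \<open>The sum of the norms is below \<open>r\<close>, so the ellipsoid centred at
    \<open>a\<close> fits into \<open>ball a r\<close>.\<close>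
  have "a \<in> G'"
  proof -
    have "a - ellipsoid_point x b \<in> G" if "b \<in> square_sum_ball" for b
      using norm_ellipsoid_point_le[OF x(1) that] x(2) r(2) by (auto simp: dist_norm)
    then show ?thesis by (auto simp: G'_def E_def)
  qed
  have "0 \<in> E"
    unfolding E_def by (intro image_eqI[of _ _ "\<lambda>i. 0"]) (auto simp: ellipsoid_point_def square_sum_ball_def)
  then have "G' \<subseteq> G" by (force simp: G'_def)
  then have "bounded G'" using G(3) bounded_subset by blast
  define V where "V n = {y. \<forall>k\<in>E. y - k \<in> - F n}" for n
  have V: "openin weak_topology (V n)" for n
    unfolding V_def using F(1)[of n] by (intro openin_weak_compact_erosion E) (simp add: closedin_def Compl_eq_Diff_UNIV)
  have "G' \<subseteq> V n" for n using F(2) by (auto simp: G'_def V_def)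
  then obtain y where y: "y \<in> closure G'" "y \<notin> G'" "\<And>n. y \<in> V n"
    using class_K_boundary_point[OF K _ \<open>open G'\<close> \<open>bounded G'\<close>, of V] V \<open>a \<in> G'\<close> by blast
  have ycl: "y - k \<in> closure G" if "k \<in> E" for k
  proof -
    have "(\<lambda>y. y - k) ` closure G' \<subseteq> closure G"
      using that closure_subset[of G] by (intro image_closure_subset continuous_intros) (auto simp: G'_def)
    then show ?thesis using y(1) by blast
  qed
  obtain b where b: "b \<in> square_sum_ball" "y - ellipsoid_point x b \<notin> G"
    using y(2) by (auto simp: G'_def E_def)
  define z where "z = y - ellipsoid_point x b"
  have zF: "z \<notin> (\<Union>n. F n)"
    using y(3) b(1) by (auto simp: z_def V_def E_def)
  have zf: "z \<in> frontier (closure G)"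
    using ycl[of "ellipsoid_point x b"] b interior_closure_convex_open[OF G(2,4)]
    by (auto simp: z_def E_def frontier_def)
  have ai: "a \<in> interior (closure G)"
    using a interior_closure_convex_open[OF G(2,4)] by simp
  let ?C = "(\<lambda>y. y - a) ` closure G"
  obtain s where s: "s > 0" "convex ?C" "ball 0 s \<subseteq> ?C"
    using gauge_body[OF G(2,4) ai] .
  have "gateaux_differentiable (minkowski_functional ?C) (z - a)"
  proof (rule gateaux_differentiable_ellipsoid_touch[OF _ _ _ x(1,3) b(1)])
    show "sublinear (minkowski_functional ?C)"
      by (rule sublinear_minkowski_functional[OF s(2,1,3)])
    show "minkowski_functional ?C u \<le> 1 / s * norm u" for u
      by (rule minkowski_functional_le_norm[OF s(2,1,3)])
    show "minkowski_functional ?C (z - a) = 1"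
      by (rule gauge_frontier[OF G(2,4) ai zf])
    fix c assume c: "c \<in> square_sum_ball"
    have "z - a + (ellipsoid_point x b - ellipsoid_point x c) = y - ellipsoid_point x c - a"
      by (simp add: z_def)
    also have "\<dots> \<in> ?C" using ycl[of "ellipsoid_point x c"] c by (auto simp: E_def)
    finally show "minkowski_functional ?C (z - a + (ellipsoid_point x b - ellipsoid_point x c)) \<le> 1"
      by (intro minkowski_functional_le[OF s(2,1,3)]) auto
  qed
  then have "smooth_point (closure G) z"
    unfolding smooth_point_def using zf ai by blast
  then show ?thesis using that zF by blast
qed

section \<open>Exposed points of the polar and the weak G-delta statement\<close>

text \<open>If the value 1 were attained at \<open>x\<close> in the open set \<open>G\<close>, a
  slight dilation of \<open>x\<close> would stay in \<open>G\<close> and exceed it.\<close>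

lemma polar_less_one:
  assumes "f \<in> polar G" "open G" "x \<in> G"
  shows "blinfun_apply f x < 1"
proof (rule ccontr)
  assume "\<not> blinfun_apply f x < 1"
  then have fx: "blinfun_apply f x = 1" using assms by (force simp: polar_def)
  obtain d where d: "d > 0" "ball x d \<subseteq> G" using assms open_contains_ball by blast
  obtain c where c: "c > 0" "c * norm x < d"
    using small_multipleE[OF d(1)] .
  then have "x + c *\<^sub>R x \<in> G" using d by (auto simp: dist_norm)
  then have "blinfun_apply f (x + c *\<^sub>R x) \<le> 1" using assms by (auto simp: polar_def)
  then show False using fx c by (simp add: blinfun.add_right blinfun.scaleR_right)
qed

lemma class_K_uncountable_wstar_exposed:
  fixes G :: "'a::banach set"
  assumes K: "class_K TYPE('a)" and sep: "separable_space (euclidean :: 'a topology)"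
    and G: "convex G" "bounded G" "open G" "0 \<in> G"
  shows "uncountable (wstar_exposed (polar G))"
proof
  assume "countable (wstar_exposed (polar G))"
  \<comment> \<open>Inserting 0 makes the set to be enumerated non-empty; it lies in the polar and
    contributes an empty \<open>F n\<close>.\<close>
  define f where "f = from_nat_into (insert 0 (wstar_exposed (polar G)))"
  have f: "range f = insert 0 (wstar_exposed (polar G))"
    unfolding f_def using \<open>countable (wstar_exposed (polar G))\<close> by (intro range_from_nat_into) auto
  define F where "F n = {x. 1 \<le> blinfun_apply (f n) x}" for n
  have "closedin weak_topology (F n)" for n
  proof -
    have "- F n = blinfun_apply (f n) -` {..<1}" by (auto simp: F_def)
    then have "openin weak_topology (- F n)"
      unfolding weak_topology_def
      by (intro topology_generated_by_Basis CollectI exI[of _ "f n"] exI[of _ "{..<1}"] conjI) auto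
    then show ?thesis by (simp add: closedin_def Compl_eq_Diff_UNIV)
  qed
  moreover have "G \<inter> (\<Union>n. F n) = {}"
  proof -
    have "f n \<in> polar G" for n
    proof -
      have "f n \<in> insert 0 (wstar_exposed (polar G))" using f by blast
      then show ?thesis by (auto simp: wstar_exposed_def polar_def)
    qed
    then have "x \<notin> F n" if "x \<in> G" for n x
      using polar_less_one[OF _ G(3) that, of "f n"] by (simp add: F_def not_le)
    then show ?thesis by blast
  qed
  ultimately obtain z where z: "smooth_point (closure G) z" "z \<notin> (\<Union>n. F n)"
    using class_K_smooth_points_not_covered[OF K sep _ G(1-3), of F] G(4) by blast
  obtain g where g: "g \<in> wstar_exposed (polar G)" "blinfun_apply g z = 1"
    using smooth_point_closureD[OF G(1,3,4) z(1)] .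
  then obtain n where "f n = g" using f by (metis insertI2 rangeE)
  then have "z \<in> F n" using g(2) by (simp add: F_def)
  then show False using z(2) by blast
qed

lemma class_K_not_weak_gdelta:
  fixes G :: "'a::banach set"
  assumes K: "class_K TYPE('a)" and G: "G \<noteq> {}" "open G" "bounded G"
  shows "\<not> gdelta_in weak_topology G"
proof
  assume "gdelta_in weak_topology G"
  then obtain U where U: "countable U" "U \<subseteq> Collect (openin weak_topology)" "\<Inter>U = G"
    unfolding gdelta_in_alt intersection_of_def by blast
  \<comment> \<open>Inserting \<open>UNIV\<close> covers an empty family \<open>U\<close> and leaves
    the intersection unchanged.\<close>
  define V where "V = from_nat_into (insert UNIV U)"
  have V: "range V = insert UNIV U"
    unfolding V_def using U(1) by (intro range_from_nat_into) auto
  have "openin weak_topology (V n)" for n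
  proof -
    have "V n \<in> insert UNIV U" using V by blast
    then show ?thesis
      using U(2) openin_topspace[of "weak_topology :: 'a topology"] by auto
  qed
  moreover have "G \<subseteq> V n" for n
  proof -
    have "V n \<in> insert UNIV U" using V by blast
    then show ?thesis using U(3) by blast
  qed
  ultimately obtain y where y: "y \<notin> G" "\<And>n. y \<in> V n"
    using class_K_boundary_point[OF K G, of V] by blast
  have "y \<in> \<Inter>(range V)" using y(2) by blast
  then show False using V U(3) y(1) by simp
qed

theorem theorem4:
  assumes "class_K TYPE('a::banach)"
    and "\<not> (\<exists>B :: 'a set. finite B \<and> span B = UNIV)"
  shows "\<not> (\<exists>G :: 'a set. G \<noteq> {} \<and> open G \<and> bounded G \<and> gdelta_in weak_topology G)
    \<and> (separable_space (euclidean :: 'a topology) \<longrightarrow>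
        (\<forall>G :: 'a set. G \<noteq> {} \<and> convex G \<and> bounded G \<and> open G \<longrightarrow>
          \<not> (\<exists>F :: nat \<Rightarrow> 'a set. (\<forall>n. closedin weak_topology (F n)) \<and>
               G \<inter> (\<Union>n. F n) = {} \<and>
               {x. smooth_point (closure G) x} \<subseteq> (\<Union>n. F n))))
    \<and> (separable_space (euclidean :: 'a topology) \<longrightarrow>
        (\<forall>G :: 'a set. convex G \<and> bounded G \<and> open G \<and> 0 \<in> G \<longrightarrow>
          uncountable (wstar_exposed (polar G))))"
proof (intro conjI impI allI notI)
  assume "\<exists>G :: 'a set. G \<noteq> {} \<and> open G \<and> bounded G \<and> gdelta_in weak_topology G"
  then show False using class_K_not_weak_gdelta[OF assms(1)] by blast
next
  fix G :: "'a set"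
  assume sep: "separable_space (euclidean :: 'a topology)"
    and G: "G \<noteq> {} \<and> convex G \<and> bounded G \<and> open G"
    and "\<exists>F :: nat \<Rightarrow> 'a set. (\<forall>n. closedin weak_topology (F n)) \<and>
               G \<inter> (\<Union>n. F n) = {} \<and> {x. smooth_point (closure G) x} \<subseteq> (\<Union>n. F n)"
  then obtain F :: "nat \<Rightarrow> 'a set" where F: "\<And>n. closedin weak_topology (F n)"
      "G \<inter> (\<Union>n. F n) = {}" "{x. smooth_point (closure G) x} \<subseteq> (\<Union>n. F n)"
    by blast
  obtain z where "smooth_point (closure G) z" "z \<notin> (\<Union>n. F n)"
    using class_K_smooth_points_not_covered[OF assms(1) sep _ _ _ _ F(1,2)] G by blast
  then show False using F(3) by blast
next
  fix G :: "'a set"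
  assume "separable_space (euclidean :: 'a topology)" "convex G \<and> bounded G \<and> open G \<and> 0 \<in> G"
    "countable (wstar_exposed (polar G))"
  then show False using class_K_uncountable_wstar_exposed[OF assms(1)] by blast
qed

end
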